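(* Let $\mathcal D=(\mathbb D,P)$ be a probabilistic database. If there exists $c\in\mathbb N_+$ such that $$\sum_{D\in\mathbb D\setminus\{\emptyset\}}|D|\cdot P(\{D\})^{c/|D|}<\infty,$$ then $\mathcal D\in\mathsf{FO}(\mathsf{TI})$.
   Context: Fix a countably infinite universe $U$. A database schema is a finite nonempty set of relation symbols with arities; facts are $R(u_1,\dots,u_{\mathrm{ar}(R)})$ with $u_i\in U$; an instance is a finite set of facts ($|D|$ is its number of facts); $\mathrm{adom}(D)$ is the set of elements of $U$ occurring in $D$. A probabilistic database (PDB) is a discrete probability space $(\mathbb D,P)$ with $\mathbb D$ a nonempty countable set of instances over a schema. A PDB $\mathcal I$ is tuple-independent if for all pairwise distinct facts $f_1,\dots,f_k$, $\Pr_{I\sim\mathcal I}(f_1\in I,\dots,f_k\in I)=\prod_i\Pr_{I\sim\mathcal I}(f_i\in I)$; $\mathsf{TI}$ is the class of tuple-independent PDBs. An FO-view consists of one first-order formula $\Phi_R(x_1,\dots,x_{\mathrm{ar}(R)})$ per output relation symbol $R$, evaluated under active domain semantics (quantifiers range over $\mathrm{adom}(D)$ and the constants of the formula), mapping $D$ to the instance containing $R(\bar a)$ for all tuples $\bar a$ over $\mathrm{adom}(D)\cup\mathrm{adom}(\Phi_R)$ with $D\models\Phi_R[\bar a]$. The image of a PDB $(\mathbb D,P)$ under a view $V$ is the PDB on $V(\mathbb D)$ with $P'(\{D'\})=P(\{D:V(D)=D'\})$. $\mathsf{FO}(\mathsf{TI})$ is the class of images of tuple-independent PDBs under FO-views.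 *)

theory Defs
  imports "HOL-Probability.Probability"
begin

text \<open>Universe U: the countably infinite set of natural numbers.
  Relation symbols: pairs (name, arity). Facts: (relation symbol, tuple).\<close>

type_synonym univ = nat
type_synonym rel = "nat \<times> nat"
type_synonym fact = "rel \<times> univ list"
type_synonym inst = "fact set"

definition arity :: "rel \<Rightarrow> nat" where "arity R = snd R"

definition schema :: "rel set \<Rightarrow> bool" where
  "schema S \<longleftrightarrow> finite S \<and> S \<noteq> {}"

definition facts_over :: "rel set \<Rightarrow> fact set" where
  "facts_over S = {(R, us). R \<in> S \<and> length us = arity R}"

definition is_instance :: "rel set \<Rightarrow> inst \<Rightarrow> bool" where
  "is_instance S D \<longleftrightarrow> finite D \<and> D \<subseteq> facts_over S"

definition adom :: "inst \<Rightarrow> univ set" where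
  "adom D = (\<Union>f\<in>D. set (snd f))"

text \<open>A PDB over schema S: a discrete probability distribution (pmf) whose
  outcomes are instances over S (the sample space is the countable support).\<close>
definition is_PDB :: "rel set \<Rightarrow> inst pmf \<Rightarrow> bool" where
  "is_PDB S P \<longleftrightarrow> schema S \<and> (\<forall>D\<in>set_pmf P. is_instance S D)"

definition tuple_independent :: "inst pmf \<Rightarrow> bool" where
  "tuple_independent P \<longleftrightarrow>
     (\<forall>F. finite F \<longrightarrow>
        measure_pmf.prob P {I. F \<subseteq> I} = (\<Prod>f\<in>F. measure_pmf.prob P {I. f \<in> I}))"

definition is_TI :: "rel set \<Rightarrow> inst pmf \<Rightarrow> bool" where
  "is_TI S P \<longleftrightarrow> is_PDB S P \<and> tuple_independent P"

datatype fo_term = Var nat | Cst univ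

datatype fo = Atom rel "fo_term list" | Eq fo_term fo_term | Neg fo | Conj fo fo | Ex nat fo

fun tval :: "(nat \<Rightarrow> univ) \<Rightarrow> fo_term \<Rightarrow> univ" where
  "tval \<sigma> (Var i) = \<sigma> i"
| "tval \<sigma> (Cst a) = a"

fun tconsts :: "fo_term \<Rightarrow> univ set" where
  "tconsts (Var i) = {}"
| "tconsts (Cst a) = {a}"

fun tvars :: "fo_term \<Rightarrow> nat set" where
  "tvars (Var i) = {i}"
| "tvars (Cst a) = {}"

fun fo_consts :: "fo \<Rightarrow> univ set" where
  "fo_consts (Atom R ts) = (\<Union>t\<in>set ts. tconsts t)"
| "fo_consts (Eq s t) = tconsts s \<union> tconsts t"
| "fo_consts (Neg \<phi>) = fo_consts \<phi>"
| "fo_consts (Conj \<phi> \<psi>) = fo_consts \<phi> \<union> fo_consts \<psi>"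
| "fo_consts (Ex x \<phi>) = fo_consts \<phi>"

fun fv :: "fo \<Rightarrow> nat set" where
  "fv (Atom R ts) = (\<Union>t\<in>set ts. tvars t)"
| "fv (Eq s t) = tvars s \<union> tvars t"
| "fv (Neg \<phi>) = fv \<phi>"
| "fv (Conj \<phi> \<psi>) = fv \<phi> \<union> fv \<psi>"
| "fv (Ex x \<phi>) = fv \<phi> - {x}"

fun rels :: "fo \<Rightarrow> rel set" where
  "rels (Atom R ts) = {R}"
| "rels (Eq s t) = {}"
| "rels (Neg \<phi>) = rels \<phi>"
| "rels (Conj \<phi> \<psi>) = rels \<phi> \<union> rels \<psi>"
| "rels (Ex x \<phi>) = rels \<phi>"

fun sat :: "inst \<Rightarrow> univ set \<Rightarrow> (nat \<Rightarrow> univ) \<Rightarrow> fo \<Rightarrow> bool" where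
  "sat D A \<sigma> (Atom R ts) \<longleftrightarrow> (R, map (tval \<sigma>) ts) \<in> D"
| "sat D A \<sigma> (Eq s t) \<longleftrightarrow> tval \<sigma> s = tval \<sigma> t"
| "sat D A \<sigma> (Neg \<phi>) \<longleftrightarrow> \<not> sat D A \<sigma> \<phi>"
| "sat D A \<sigma> (Conj \<phi> \<psi>) \<longleftrightarrow> sat D A \<sigma> \<phi> \<and> sat D A \<sigma> \<psi>"
| "sat D A \<sigma> (Ex x \<phi>) \<longleftrightarrow> (\<exists>a\<in>A. sat D A (\<sigma>(x := a)) \<phi>)"

definition FO_view :: "rel set \<Rightarrow> rel set \<Rightarrow> (rel \<Rightarrow> fo) \<Rightarrow> bool" where
  "FO_view S S' \<Phi> \<longleftrightarrow> schema S' \<and>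
     (\<forall>R\<in>S'. fv (\<Phi> R) \<subseteq> {..<arity R} \<and> rels (\<Phi> R) \<subseteq> S)"

definition tuple_assign :: "univ list \<Rightarrow> nat \<Rightarrow> univ" where
  "tuple_assign as i = (if i < length as then as ! i else 0)"

definition apply_view :: "rel set \<Rightarrow> (rel \<Rightarrow> fo) \<Rightarrow> inst \<Rightarrow> inst" where
  "apply_view S' \<Phi> D =
     {(R, as). R \<in> S' \<and> length as = arity R \<and> set as \<subseteq> adom D \<union> fo_consts (\<Phi> R) \<and>
               sat D (adom D \<union> fo_consts (\<Phi> R)) (tuple_assign as) (\<Phi> R)}"

definition in_FO_TI :: "rel set \<Rightarrow> inst pmf \<Rightarrow> bool" where
  "in_FO_TI S P \<longleftrightarrow> (\<exists>S0 P0 \<Phi>. is_TI S0 P0 \<and> FO_view S0 S \<Phi> \<and>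
                                   map_pmf (apply_view S \<Phi>) P0 = P)"

end

theory Submission
  imports Defs
begin

text \<open>
  Split the support of \<open>P\<close> into a finite set \<open>F\<close> of probability more than \<open>3/4\<close>, which takes
  up the empty instance if it occurs, and the rest \<open>B\<close>.
  Each \<open>D \<in> B\<close> is represented by a block of about \<open>|D| / c\<close> independent facts, each carrying at
  most \<open>2c\<close> facts of \<open>D\<close>, with marginals chosen so that the whole block is present with odds
  \<open>2 P(D)\<close>; the summability hypothesis makes the sum of these marginals finite. The facts of a
  block are linked into a cycle, so a first-order formula recognises a complete block as a nonempty
  set of facts with a common key that is closed under successors. The probability that the block of
  \<open>D\<close> is the only complete one is \<open>2 P(D) Z\<close>, where \<open>Z > 1/2\<close> is the probability that no block is
  complete. An independent coin of bias \<open>1 / (2Z)\<close> corrects this to \<open>P(D)\<close>. When there is no unique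
  complete block or the coin fails, the view outputs an element of \<open>F\<close>, selected by finitely many
  further coins and hard-wired into the formula by means of constants.
\<close>

section \<open>Random finite sets with independent membership\<close>

text \<open>Neither factor has to be normalised: the marginals are \<open>G\<close> times the total
  mass of \<open>H\<close> and \<open>H\<close> times the total mass of \<open>G\<close>, and the
  product of these two masses is the total mass 1 of \<open>J\<close>.\<close>

lemma pair_pmf_if_pmf_factors:
  assumes J: "\<And>x y. pmf J (x, y) = G x * H y"
    and G: "\<And>x. G x \<ge> 0" and H: "\<And>y. H y \<ge> 0"
  shows "J = pair_pmf (map_pmf fst J) (map_pmf snd J)"
proof -
  define g h where "g = (\<integral>\<^sup>+x. ennreal (G x) \<partial>count_space UNIV)"
    and "h = (\<integral>\<^sup>+y. ennreal (H y) \<partial>count_space UNIV)"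
  have fst: "ennreal (pmf (map_pmf fst J) x) = ennreal (G x) * h" for x
  proof -
    have "ennreal (pmf (map_pmf fst J) x) = emeasure J (fst -` {x})"
      by (simp add: emeasure_pmf_single[symmetric])
    also have "\<dots> = (\<integral>\<^sup>+p. ennreal (pmf J p) \<partial>count_space (fst -` {x}))"
      by (simp add: nn_integral_pmf)
    also have "\<dots> = (\<integral>\<^sup>+y. ennreal (pmf J (x, y)) \<partial>count_space UNIV)"
      by (intro nn_integral_bij_count_space[symmetric]) (auto simp: bij_betw_def inj_on_def)
    also have "\<dots> = ennreal (G x) * h"
      by (simp add: J G H ennreal_mult nn_integral_cmult h_def)
    finally show ?thesis .
  qed
  have snd: "ennreal (pmf (map_pmf snd J) y) = g * ennreal (H y)" for y
  proof -
    have "ennreal (pmf (map_pmf snd J) y) = emeasure J (snd -` {y})"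
      by (simp add: emeasure_pmf_single[symmetric])
    also have "\<dots> = (\<integral>\<^sup>+p. ennreal (pmf J p) \<partial>count_space (snd -` {y}))"
      by (simp add: nn_integral_pmf)
    also have "\<dots> = (\<integral>\<^sup>+x. ennreal (pmf J (x, y)) \<partial>count_space UNIV)"
      by (intro nn_integral_bij_count_space[symmetric, where g = "\<lambda>x. (x, y)"])
         (auto simp: bij_betw_def inj_on_def)
    also have "\<dots> = g * ennreal (H y)"
      by (simp add: J G H ennreal_mult nn_integral_multc g_def)
    finally show ?thesis .
  qed
  have "1 = (\<integral>\<^sup>+x. ennreal (pmf (map_pmf fst J) x) \<partial>count_space UNIV)"
    by (simp only: nn_integral_pmf) simp
  also have "\<dots> = g * h"
    by (simp add: fst nn_integral_multc g_def)
  finally have gh: "g * h = 1" ..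
  show ?thesis
  proof (rule pmf_eqI, safe)
    fix x y
    have "ennreal (pmf (pair_pmf (map_pmf fst J) (map_pmf snd J)) (x, y))
        = (ennreal (G x) * h) * (g * ennreal (H y))"
      by (simp add: pmf_pair ennreal_mult fst snd)
    also have "\<dots> = ennreal (G x) * ennreal (H y) * (g * h)"
      by (simp add: mult_ac)
    also have "\<dots> = ennreal (pmf J (x, y))"
      by (simp add: gh J ennreal_mult G H)
    finally show "pmf J (x, y) = pmf (pair_pmf (map_pmf fst J) (map_pmf snd J)) (x, y)"
      by simp
  qed
qed

lemma prob_pair_pmf_Times:
  "measure_pmf.prob (pair_pmf p q) (A \<times> B) = measure_pmf.prob p A * measure_pmf.prob q B"
proof -
  have "emeasure (pair_pmf p q) (A \<times> B)
      = (\<integral>\<^sup>+a. \<integral>\<^sup>+b. indicator A a * indicator B b \<partial>measure_pmf q \<partial>measure_pmf p)"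
    by (simp add: nn_integral_indicator[symmetric] nn_integral_pair_pmf' indicator_times
        del: nn_integral_indicator)
  also have "\<dots> = emeasure p A * emeasure q B"
    by (simp add: nn_integral_cmult nn_integral_multc)
  finally show ?thesis
    by (simp add: measure_pmf.emeasure_eq_measure ennreal_mult[symmetric])
qed

text \<open>Union bound for events indexed by an arbitrary countable set such as a set of instances:
  the indicator of a union is at most the sum of the indicators, and the two integrals may be
  exchanged.\<close>

lemma emeasure_pmf_countable_subadditive:
  assumes "countable B"
  shows "emeasure (measure_pmf Q) {x. \<exists>i\<in>B. R i x}
       \<le> (\<integral>\<^sup>+i. emeasure (measure_pmf Q) {x. R i x} \<partial>count_space B)"
proof -
  have "emeasure (measure_pmf Q) {x. \<exists>i\<in>B. R i x}
      = (\<integral>\<^sup>+x. indicator {x. \<exists>i\<in>B. R i x} x \<partial>measure_pmf Q)"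
    by simp
  also have "\<dots> \<le> (\<integral>\<^sup>+x. \<integral>\<^sup>+i. indicator {x. R i x} x \<partial>count_space B \<partial>measure_pmf Q)"
  proof (rule nn_integral_mono)
    fix x
    show "indicator {x. \<exists>i\<in>B. R i x} x \<le> (\<integral>\<^sup>+i. indicator {x. R i x} x \<partial>count_space B)"
    proof (cases "\<exists>i\<in>B. R i x")
      case True
      then obtain i where i: "i \<in> B" "R i x" by blast
      have "(\<integral>\<^sup>+i'. indicator {i} i' \<partial>count_space B)
          \<le> (\<integral>\<^sup>+i'. indicator {x. R i' x} x \<partial>count_space B)"
        using i by (intro nn_integral_mono) (auto simp: indicator_def)
      with i True show ?thesis by simp
    qed simp
  qed
  also have "\<dots> = (\<integral>\<^sup>+i. \<integral>\<^sup>+x. indicator {x. R i x} x \<partial>measure_pmf Q \<partial>count_space B)"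
    using assms by (rule nn_integral_count_space_nn_integral) auto
  finally show ?thesis
    by simp
qed

text \<open>Finitely many finite sets are subsets of their union, and the products over all subsets
  of a finite set add up to the product of the \<open>w x + 1\<close>, which is at most the
  exponential of the sum of \<open>w\<close>.\<close>

lemma summable_on_prod_finite_sets:
  fixes w :: "'a \<Rightarrow> real"
  assumes w: "\<And>x. w x \<ge> 0" and sum: "w summable_on UNIV"
  shows "(\<lambda>I. if finite I then \<Prod>x\<in>I. w x else 0) summable_on UNIV"
proof (rule nonneg_bdd_above_summable_on)
  show "bdd_above (sum (\<lambda>I. if finite I then \<Prod>x\<in>I. w x else 0) ` {F. F \<subseteq> UNIV \<and> finite F})"
  proof (rule bdd_aboveI2)
    fix F :: "'a set set" assume "F \<in> {F. F \<subseteq> UNIV \<and> finite F}"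
    then have fin: "finite F" by simp
    define F' where "F' = {I\<in>F. finite I}"
    have fin': "finite F'" "finite (\<Union>F')"
      using fin by (auto simp: F'_def)
    have "(\<Sum>I\<in>F. if finite I then \<Prod>x\<in>I. w x else 0) = (\<Sum>I\<in>F'. \<Prod>x\<in>I. w x)"
      by (simp add: F'_def fin sum.inter_filter)
    also have "\<dots> \<le> (\<Sum>I\<in>Pow (\<Union>F'). \<Prod>x\<in>I. w x)"
      using fin' w by (intro sum_mono2) (auto intro: prod_nonneg)
    also have "\<dots> = (\<Prod>x\<in>\<Union>F'. w x + 1)"
      using fin' by (simp add: prod_add)
    also have "\<dots> \<le> (\<Prod>x\<in>\<Union>F'. exp (w x))"
      using w by (intro prod_mono) (auto simp: exp_ge_add_one_self add.commute add_nonneg_nonneg)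
    also have "\<dots> = exp (\<Sum>x\<in>\<Union>F'. w x)"
      using fin' by (simp add: exp_sum)
    also have "\<dots> \<le> exp (infsum w UNIV)"
      using fin' w sum by (simp add: finite_sum_le_infsum)
    finally show "(\<Sum>I\<in>F. if finite I then \<Prod>x\<in>I. w x else 0) \<le> exp (infsum w UNIV)" .
  qed
qed (auto intro: prod_nonneg w)

text \<open>By summability only finitely many \<open>p x\<close> reach 1/2, and at all other points
  the odds are at most \<open>2 * p x\<close>.\<close>

lemma summable_on_odds:
  fixes p :: "'a \<Rightarrow> real"
  assumes p: "\<And>x. 0 \<le> p x" "\<And>x. p x < 1" and sum: "p summable_on UNIV"
  shows "(\<lambda>x. p x / (1 - p x)) summable_on UNIV"
proof -
  let ?A = "{x. p x \<ge> 1/2}"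
  have "finite ?A"
  proof (rule ccontr)
    assume inf: "infinite ?A"
    obtain n :: nat where n: "real n > 2 * infsum p UNIV"
      using reals_Archimedean2 by blast
    obtain C where C: "C \<subseteq> ?A" "finite C" "card C = n"
      using infinite_arbitrarily_large[OF inf] by blast
    have "real n / 2 = (\<Sum>x\<in>C. 1/2)"
      using C by simp
    also have "\<dots> \<le> sum p C"
      using C by (intro sum_mono) auto
    also have "\<dots> \<le> infsum p UNIV"
      using C p sum by (intro finite_sum_le_infsum) auto
    finally show False
      using n by simp
  qed
  moreover have "(\<lambda>x. p x / (1 - p x)) summable_on - ?A"
  proof (rule summable_on_comparison_test)
    show "(\<lambda>x. 2 * p x) summable_on - ?A"
      by (intro summable_on_cmult_right summable_on_subset_banach[OF sum]) auto
    fix x assume "x \<in> - ?A"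
    then have x: "p x < 1/2" by simp
    have "p x * 1 \<le> p x * (2 * (1 - p x))"
      using x p(1)[of x] by (intro mult_left_mono) auto
    then show "p x / (1 - p x) \<le> 2 * p x"
      using p(2)[of x] by (simp add: field_simps)
  qed (use p in \<open>auto simp: less_imp_le\<close>)
  ultimately have "(\<lambda>x. p x / (1 - p x)) summable_on (?A \<union> - ?A)"
    by (intro summable_on_Un_disjoint) auto
  then show ?thesis by simp
qed

text \<open>Independence is expressed through the traces on a set and on its complement, for
  arbitrary events on each side. This covers events about infinitely many elements, such as no other
  block being full.\<close>

definition independent_inclusion :: "('a \<Rightarrow> real) \<Rightarrow> 'a set pmf \<Rightarrow> bool" where
  "independent_inclusion p Q \<longleftrightarrow>
     (\<forall>I\<in>set_pmf Q. finite I \<and> (\<forall>x\<in>I. p x > 0)) \<and>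
     (\<forall>x. measure_pmf.prob Q {I. x \<in> I} = p x) \<and>
     (\<forall>A X Y. measure_pmf.prob Q {I. I \<inter> A \<in> X \<and> I - A \<in> Y} =
        measure_pmf.prob Q {I. I \<inter> A \<in> X} * measure_pmf.prob Q {I. I - A \<in> Y})"

text \<open>A finite set gets a probability proportional to the product of the odds of its elements.
  Normalising by the total weight \<open>W\<close> takes the place of the infinite product of the
  factors \<open>1 - p x\<close>.\<close>

lemma independent_inclusion_exists:
  fixes p :: "'a \<Rightarrow> real"
  assumes p: "\<And>x. 0 \<le> p x" "\<And>x. p x < 1" and sum: "p summable_on UNIV"
  shows "\<exists>Q. independent_inclusion p Q"
proof -
  define w where "w x = p x / (1 - p x)" for x
  define f where "f I = (if finite I then \<Prod>x\<in>I. w x else 0)" for I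
  have w: "w x \<ge> 0" for x
    using p[of x] by (simp add: w_def)
  have f: "f I \<ge> 0" for I
    by (simp add: f_def prod_nonneg w)
  have fs: "f summable_on UNIV"
    unfolding f_def using w summable_on_odds[OF assms]
    by (intro summable_on_prod_finite_sets) (auto simp: w_def)
  define W where "W = infsum f UNIV"
  have "Infinite_Set_Sum.abs_summable_on f UNIV"
    using fs f by (simp add: abs_summable_equivalent[symmetric])
  then have W: "(\<integral>\<^sup>+I. ennreal (f I) \<partial>count_space UNIV) = ennreal W"
    by (simp add: nn_integral_conv_infsetsum f infsetsum_infsum W_def)
  have "f {} \<le> W"
    using finite_sum_le_infsum[OF fs, of "{{}}"] f by (simp add: W_def)
  then have W0: "W > 0"
    by (simp add: f_def)
  define Q where "Q = embed_pmf (\<lambda>I. f I / W)"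
  have Q: "pmf Q I = f I / W" for I
    unfolding Q_def
  proof (rule pmf_embed_pmf)
    have "(\<integral>\<^sup>+I. ennreal (f I / W) \<partial>count_space UNIV)
        = (\<integral>\<^sup>+I. ennreal (f I) * ennreal (1 / W) \<partial>count_space UNIV)"
      using f W0 by (intro nn_integral_cong) (simp flip: ennreal_mult)
    also have "\<dots> = 1"
      using W0 by (simp add: nn_integral_multc W flip: ennreal_mult)
    finally show "(\<integral>\<^sup>+I. ennreal (f I / W) \<partial>count_space UNIV) = 1" .
  qed (use f W0 in auto)
  have supp: "finite I \<and> (\<forall>x\<in>I. p x > 0)" if "I \<in> set_pmf Q" for I
  proof -
    have "f I \<noteq> 0"
      using that by (auto simp: set_pmf_iff Q)
    then have I: "finite I" "\<forall>x\<in>I. w x \<noteq> 0"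
      by (auto simp: f_def split: if_splits)
    have "p x > 0" if "x \<in> I" for x
      using I that p(1)[of x] by (auto simp: w_def less_eq_real_def)
    with I show ?thesis by blast
  qed
  have indep: "measure_pmf.prob Q {I. I \<inter> A \<in> X \<and> I - A \<in> Y} =
      measure_pmf.prob Q {I. I \<inter> A \<in> X} * measure_pmf.prob Q {I. I - A \<in> Y}" for A X Y
  proof -
    define s where "s I = (I \<inter> A, I - A)" for I
    define J where "J = map_pmf s Q"
    have inj: "inj s"
      by (auto simp: s_def inj_on_def)
    \<comment> \<open>The weight \<open>f\<close> is multiplicative on disjoint unions, so the joint
      law of the two traces factors; the constant \<open>1 / W\<close> is attached to the second
      factor.\<close>
    have J: "pmf J (U, V) = (if U \<subseteq> A then f U else 0) * (if V \<inter> A = {} then f V / W else 0)" for U V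
    proof (cases "U \<subseteq> A \<and> V \<inter> A = {}")
      case True
      then have s: "(U, V) = s (U \<union> V)"
        by (auto simp: s_def)
      have "pmf J (U, V) = f (U \<union> V) / W"
        unfolding J_def s by (simp add: pmf_map_inj' inj Q)
      also have "f (U \<union> V) = f U * f V"
        using True by (auto simp: f_def intro!: prod.union_disjoint)
      finally show ?thesis
        using True by simp
    next
      case False
      then have "(U, V) \<notin> set_pmf J"
        by (auto simp: J_def s_def)
      with False show ?thesis
        by (auto simp: set_pmf_iff)
    qed
    have "measure_pmf.prob Q {I. I \<inter> A \<in> X \<and> I - A \<in> Y} = measure_pmf.prob J (X \<times> Y)"
      by (auto simp: J_def s_def vimage_def)
    also have "\<dots> = measure_pmf.prob (pair_pmf (map_pmf fst J) (map_pmf snd J)) (X \<times> Y)"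
      using J by (subst pair_pmf_if_pmf_factors[OF J]) (auto simp: f W0 less_imp_le)
    also have "\<dots> = measure_pmf.prob Q {I. I \<inter> A \<in> X} * measure_pmf.prob Q {I. I - A \<in> Y}"
      by (simp add: prob_pair_pmf_Times J_def s_def vimage_def map_pmf_comp)
    finally show ?thesis .
  qed
  have marg: "measure_pmf.prob Q {I. x \<in> I} = p x" for x
  proof -
    \<comment> \<open>Inserting \<open>x\<close> is a bijection from the sets without
      \<open>x\<close> to the sets with \<open>x\<close> and multiplies the weight by
      \<open>w x\<close>. So the odds of \<open>x\<close> are \<open>w x\<close>, which makes its
      probability \<open>p x\<close>.\<close>
    have *: "emeasure Q {I. x \<in> I} = ennreal (w x) * emeasure Q {I. x \<notin> I}"
    proof -
      have "emeasure Q {I. x \<in> I} = (\<integral>\<^sup>+I. ennreal (pmf Q I) \<partial>count_space {I. x \<in> I})"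
        by (simp add: nn_integral_pmf)
      also have "\<dots> = (\<integral>\<^sup>+I. ennreal (pmf Q (insert x I)) \<partial>count_space {I. x \<notin> I})"
      proof (rule nn_integral_bij_count_space[symmetric])
        show "bij_betw (insert x) {I. x \<notin> I} {I. x \<in> I}"
          by (rule bij_betw_byWitness[where f' = "\<lambda>I. I - {x}"]) auto
      qed
      also have "\<dots> = (\<integral>\<^sup>+I. ennreal (w x) * ennreal (pmf Q I) \<partial>count_space {I. x \<notin> I})"
        using f W0 w by (intro nn_integral_cong) (auto simp: Q f_def prod_nonneg simp flip: ennreal_mult)
      finally show ?thesis
        by (simp add: nn_integral_cmult nn_integral_pmf)
    qed
    then have "measure_pmf.prob Q {I. x \<in> I} = w x * measure_pmf.prob Q {I. x \<notin> I}"
      by (simp add: measure_pmf.emeasure_eq_measure w flip: ennreal_mult)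
    moreover have "measure_pmf.prob Q {I. x \<notin> I} = 1 - measure_pmf.prob Q {I. x \<in> I}"
      using measure_pmf.prob_compl[of "{I. x \<in> I}" Q] by (simp add: Compl_eq_Diff_UNIV[symmetric] Collect_neg_eq)
    ultimately show ?thesis
      using p[of x] by (simp add: w_def field_simps)
  qed
  show ?thesis
    using supp marg indep unfolding independent_inclusion_def by blast
qed

text \<open>The independence clause for a singleton splits off one element at a time: the excluded
  ones in the base case, then the included ones.\<close>

lemma independent_inclusion_prob_finite:
  assumes Q: "independent_inclusion p Q"
    and "finite F" "finite G" "F \<inter> G = {}"
  shows "measure_pmf.prob Q {I. F \<subseteq> I \<and> G \<inter> I = {}} = (\<Prod>x\<in>F. p x) * (\<Prod>x\<in>G. 1 - p x)"
  using assms(2-)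
proof (induction F arbitrary: G rule: finite_induct)
  case empty
  from empty.prems(1) show ?case
  proof (induction G rule: finite_induct)
    case (insert g G)
    have "measure_pmf.prob Q {I. {} \<subseteq> I \<and> insert g G \<inter> I = {}}
        = measure_pmf.prob Q {I. I \<inter> {g} \<in> {{}} \<and> I - {g} \<in> {V. G \<inter> V = {}}}"
      using insert.hyps by (intro arg_cong[where f = "measure_pmf.prob Q"]) auto
    also have "\<dots> = measure_pmf.prob Q {I. I \<inter> {g} \<in> {{}}} * measure_pmf.prob Q {I. I - {g} \<in> {V. G \<inter> V = {}}}"
      using Q unfolding independent_inclusion_def by blast
    also have "{I. I - {g} \<in> {V. G \<inter> V = {}}} = {I. {} \<subseteq> I \<and> G \<inter> I = {}}"
      using insert.hyps by auto
    also have "{I. I \<inter> {g} \<in> {{}}} = UNIV - {I. g \<in> I}"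
      by auto
    also have "measure_pmf.prob Q \<dots> = 1 - p g"
      using measure_pmf.prob_compl[of "{I. g \<in> I}" Q] Q by (simp add: independent_inclusion_def)
    finally show ?case
      using insert by simp
  qed simp
next
  case (insert f F)
  have "measure_pmf.prob Q {I. insert f F \<subseteq> I \<and> G \<inter> I = {}}
      = measure_pmf.prob Q {I. I \<inter> {f} \<in> {{f}} \<and> I - {f} \<in> {V. F \<subseteq> V \<and> G \<inter> V = {}}}"
    using insert.hyps insert.prems by (intro arg_cong[where f = "measure_pmf.prob Q"]) auto
  also have "\<dots> = measure_pmf.prob Q {I. I \<inter> {f} \<in> {{f}}} * measure_pmf.prob Q {I. I - {f} \<in> {V. F \<subseteq> V \<and> G \<inter> V = {}}}"
    using Q unfolding independent_inclusion_def by blast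
  also have "{I. I - {f} \<in> {V. F \<subseteq> V \<and> G \<inter> V = {}}} = {I. F \<subseteq> I \<and> G \<inter> I = {}}"
    using insert.hyps insert.prems by auto
  also have "{I. I \<inter> {f} \<in> {{f}}} = {I. f \<in> I}"
    by auto
  also have "measure_pmf.prob Q \<dots> = p f"
    using Q by (simp add: independent_inclusion_def)
  finally show ?case
    using insert by (simp add: mult_ac)
qed

lemma tuple_independent_if_independent_inclusion:
  assumes "independent_inclusion p Q"
  shows "tuple_independent Q"
proof -
  have "measure_pmf.prob Q {I. f \<in> I} = p f" for f
    using assms unfolding independent_inclusion_def by blast
  then show ?thesis
    using independent_inclusion_prob_finite[OF assms, of _ "{}"]
    unfolding tuple_independent_def by simp
qed

text \<open>Facts inside \<open>A\<close> can only come from the first component and facts outside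
  \<open>A\<close> only from the second, so inclusion of \<open>F\<close> splits into events of two
  independent components.\<close>

lemma tuple_independent_Un:
  assumes Q1: "tuple_independent Q1" "\<And>I. I \<in> set_pmf Q1 \<Longrightarrow> I \<subseteq> A"
    and Q2: "tuple_independent Q2" "\<And>I. I \<in> set_pmf Q2 \<Longrightarrow> I \<inter> A = {}"
  shows "tuple_independent (map_pmf (\<lambda>(I, J). I \<union> J) (pair_pmf Q1 Q2))"
  unfolding tuple_independent_def
proof (intro allI impI)
  fix F :: "fact set" assume F: "finite F"
  let ?Q = "map_pmf (\<lambda>(I, J). I \<union> J) (pair_pmf Q1 Q2)"
  have *: "measure_pmf.prob ?Q {I. G \<subseteq> I}
     = measure_pmf.prob Q1 {I. G \<inter> A \<subseteq> I} * measure_pmf.prob Q2 {I. G - A \<subseteq> I}" for G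
  proof -
    have "measure_pmf.prob ?Q {I. G \<subseteq> I}
        = measure_pmf.prob (pair_pmf Q1 Q2) {(I, J). G \<subseteq> I \<union> J}"
      by (simp add: vimage_def case_prod_unfold)
    also have "\<dots> = measure_pmf.prob (pair_pmf Q1 Q2) ({I. G \<inter> A \<subseteq> I} \<times> {I. G - A \<subseteq> I})"
      using Q1(2) Q2(2) by (intro measure_prob_cong_0) (force simp: pmf_pair set_pmf_iff)+
    finally show ?thesis
      by (simp add: prob_pair_pmf_Times)
  qed
  have "measure_pmf.prob Q1 {I. {f} \<inter> A \<subseteq> I} * measure_pmf.prob Q2 {I. {f} - A \<subseteq> I}
      = (if f \<in> A then measure_pmf.prob Q1 {I. f \<in> I} else measure_pmf.prob Q2 {I. f \<in> I})" for f
    by (auto simp: insert_Diff_if)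
  with *[of "{_}"] have single: "measure_pmf.prob ?Q {I. f \<in> I}
      = (if f \<in> A then measure_pmf.prob Q1 {I. f \<in> I} else measure_pmf.prob Q2 {I. f \<in> I})" for f
    by simp
  have "measure_pmf.prob ?Q {I. F \<subseteq> I}
      = (\<Prod>f\<in>F \<inter> A. measure_pmf.prob Q1 {I. f \<in> I}) * (\<Prod>f\<in>F - A. measure_pmf.prob Q2 {I. f \<in> I})"
    using Q1(1) Q2(1) F unfolding * tuple_independent_def by simp
  also have "\<dots> = (\<Prod>f\<in>F. measure_pmf.prob ?Q {I. f \<in> I})"
    using F unfolding single by (simp add: prod.If_cases Diff_eq)
  finally show "measure_pmf.prob ?Q {I. F \<subseteq> I} = (\<Prod>f\<in>F. measure_pmf.prob ?Q {I. f \<in> I})" .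
qed

section \<open>First-order formulas for the view\<close>

definition fo_True :: fo where "fo_True = Eq (Cst 0) (Cst 0)"

definition Conjs :: "fo list \<Rightarrow> fo" where "Conjs \<phi>s = foldr Conj \<phi>s fo_True"

definition Disjs :: "fo list \<Rightarrow> fo" where "Disjs \<phi>s = Neg (Conjs (map Neg \<phi>s))"

fun exs :: "nat \<Rightarrow> nat \<Rightarrow> fo \<Rightarrow> fo" where
  "exs b 0 \<phi> = \<phi>"
| "exs b (Suc n) \<phi> = Ex b (exs (Suc b) n \<phi>)"

definition upd :: "(nat \<Rightarrow> univ) \<Rightarrow> nat \<Rightarrow> univ list \<Rightarrow> nat \<Rightarrow> univ" where
  "upd \<sigma> b as i = (if b \<le> i \<and> i < b + length as then as ! (i - b) else \<sigma> i)"

lemma sat_Conjs [simp]: "sat D A \<sigma> (Conjs \<phi>s) \<longleftrightarrow> (\<forall>\<phi>\<in>set \<phi>s. sat D A \<sigma> \<phi>)"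
  by (induction \<phi>s) (auto simp: Conjs_def fo_True_def)

lemma fv_Conjs [simp]: "fv (Conjs \<phi>s) = (\<Union>\<phi>\<in>set \<phi>s. fv \<phi>)"
  by (induction \<phi>s) (auto simp: Conjs_def fo_True_def)

lemma rels_Conjs [simp]: "rels (Conjs \<phi>s) = (\<Union>\<phi>\<in>set \<phi>s. rels \<phi>)"
  by (induction \<phi>s) (auto simp: Conjs_def fo_True_def)

text \<open>The element \<open>0\<close> stems from \<open>fo_True\<close>. It merely enlarges the
  range of the quantifiers, and the semantic lemmas below admit every range that contains the
  elements of the \<open>T\<close>-facts.\<close>

lemma fo_consts_Conjs: "fo_consts (Conjs \<phi>s) = insert 0 (\<Union>\<phi>\<in>set \<phi>s. fo_consts \<phi>)"
  by (induction \<phi>s) (auto simp: Conjs_def fo_True_def)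

lemma sat_Disjs [simp]: "sat D A \<sigma> (Disjs \<phi>s) \<longleftrightarrow> (\<exists>\<phi>\<in>set \<phi>s. sat D A \<sigma> \<phi>)"
  by (auto simp: Disjs_def)

lemma fv_Disjs [simp]: "fv (Disjs \<phi>s) = (\<Union>\<phi>\<in>set \<phi>s. fv \<phi>)"
  by (auto simp: Disjs_def)

lemma rels_Disjs [simp]: "rels (Disjs \<phi>s) = (\<Union>\<phi>\<in>set \<phi>s. rels \<phi>)"
  by (auto simp: Disjs_def)

lemma fo_consts_Disjs: "fo_consts (Disjs \<phi>s) = insert 0 (\<Union>\<phi>\<in>set \<phi>s. fo_consts \<phi>)"
  by (auto simp: Disjs_def fo_consts_Conjs)

lemma fv_exs [simp]: "fv (exs b n \<phi>) = fv \<phi> - {b..<b + n}"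
  by (induction n arbitrary: b) auto

lemma rels_exs [simp]: "rels (exs b n \<phi>) = rels \<phi>"
  by (induction n arbitrary: b) auto

lemma upd_Cons: "upd \<sigma> b (a # as) = upd (\<sigma>(b := a)) (Suc b) as"
  by (auto simp: upd_def fun_eq_iff nth_Cons')

lemma upd_Nil [simp]: "upd \<sigma> b [] = \<sigma>"
  by (auto simp: upd_def fun_eq_iff)

lemma upd_inside [simp]: "j < length as \<Longrightarrow> upd \<sigma> b as (b + j) = as ! j"
  by (auto simp: upd_def)

lemma upd_less [simp]: "i < b \<Longrightarrow> upd \<sigma> b as i = \<sigma> i"
  by (auto simp: upd_def)

lemma sat_exs:
  "sat D A \<sigma> (exs b n \<phi>) \<longleftrightarrow> (\<exists>as. length as = n \<and> set as \<subseteq> A \<and> sat D A (upd \<sigma> b as) \<phi>)"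
proof (induction n arbitrary: b \<sigma>)
  case (Suc n)
  show ?case (is "_ = ?R")
  proof
    assume "sat D A \<sigma> (exs b (Suc n) \<phi>)"
    then obtain a as where "a \<in> A" "length as = n" "set as \<subseteq> A" "sat D A (upd (\<sigma>(b := a)) (Suc b) as) \<phi>"
      by (auto simp: Suc simp del: fun_upd_apply)
    then show ?R
      by (intro exI[of _ "a # as"]) (auto simp: upd_Cons)
  next
    assume ?R
    then obtain as where as: "length as = Suc n" "set as \<subseteq> A" "sat D A (upd \<sigma> b as) \<phi>" by blast
    then obtain a as' where "as = a # as'" by (cases as) auto
    with as show "sat D A \<sigma> (exs b (Suc n) \<phi>)"
      by (auto simp: Suc upd_Cons simp del: fun_upd_apply)
  qed
qed auto

section \<open>Formulas recognising complete blocks\<close>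

definition var_block :: "nat \<Rightarrow> nat \<Rightarrow> fo_term list" where
  "var_block b n = map (\<lambda>j. Var (b + j)) [0..<n]"

lemma map_tval_var_block [simp]: "length as = n \<Longrightarrow> map (tval (upd \<sigma> b as)) (var_block b n) = as"
  by (auto simp: var_block_def intro!: nth_equalityI)

lemma tvars_var_block [simp]: "(\<Union>t\<in>set (var_block b n). tvars t) = {b..<b + n}"
proof -
  have "set (var_block b n) = Var ` ((+) b ` {0..<n})"
    unfolding var_block_def set_map set_upt image_image ..
  then show ?thesis by (simp only: image_add_atLeastLessThan) auto
qed

text \<open>Column \<open>0\<close> of \<open>ys\<close> is the index of a fact and column
  \<open>1\<close> the index of its successor on the cycle. Closure under successors is first-order
  and uses no bound on the number of facts in a block, which varies with the instance.\<close>

definition complete_key :: "rel \<Rightarrow> inst \<Rightarrow> univ \<Rightarrow> bool" where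
  "complete_key T I z \<longleftrightarrow> (\<exists>ys. (T, z # ys) \<in> I) \<and>
     (\<forall>ys. (T, z # ys) \<in> I \<longrightarrow> (\<exists>ys'. (T, z # ys') \<in> I \<and> ys' ! 0 = ys ! 1))"

definition unique_key :: "rel \<Rightarrow> inst \<Rightarrow> univ \<Rightarrow> bool" where
  "unique_key T I z \<longleftrightarrow> complete_key T I z \<and> (\<forall>z'. complete_key T I z' \<longrightarrow> z' = z)"

text \<open>Variables below \<open>r\<close> are reserved for the output tuple; \<open>r\<close> and \<open>r + 1\<close> hold keys, and two
  blocks of \<open>n\<close> variables starting at \<open>r + 2\<close> hold the remaining columns of a \<open>T\<close>-fact.\<close>

definition complete_fo :: "rel \<Rightarrow> nat \<Rightarrow> nat \<Rightarrow> nat \<Rightarrow> fo" where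
  "complete_fo T n r v =
     Conj (exs (r + 2) n (Atom T (Var v # var_block (r + 2) n)))
       (Neg (exs (r + 2) n (Conj (Atom T (Var v # var_block (r + 2) n))
         (Neg (exs (r + 2 + n) n (Conj (Atom T (Var v # var_block (r + 2 + n) n))
            (Eq (Var (r + 2 + n)) (Var (r + 3)))))))))"

definition unique_fo :: "rel \<Rightarrow> nat \<Rightarrow> nat \<Rightarrow> fo" where
  "unique_fo T n r = Conj (complete_fo T n r r)
     (Neg (Ex (r + 1) (Conj (complete_fo T n r (r + 1)) (Neg (Eq (Var (r + 1)) (Var r))))))"

text \<open>Guarantees that quantification over \<open>n\<close> columns with values in
  \<open>A\<close> misses no \<open>T\<close>-fact.\<close>

definition in_range :: "rel \<Rightarrow> nat \<Rightarrow> univ set \<Rightarrow> inst \<Rightarrow> bool" where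
  "in_range T n A I \<longleftrightarrow> (\<forall>z ys. (T, z # ys) \<in> I \<longrightarrow> length ys = n \<and> z \<in> A \<and> set ys \<subseteq> A)"

lemma sat_complete_fo:
  assumes I: "in_range T n A I" and v: "v < r + 2" and n: "n \<ge> 2"
  shows "sat I A \<sigma> (complete_fo T n r v) \<longleftrightarrow> complete_key T I (\<sigma> v)"
proof -
  \<comment> \<open>Variable \<open>r + 3\<close> is the second one of the first quantified block
    and thus holds the successor index, to be matched with the first variable of the second
    block.\<close>
  have 1: "upd \<sigma>' (r + 2) ys (r + 3) = ys ! 1" if "length ys \<ge> 2" for ys \<sigma>'
    using upd_inside[of 1 ys \<sigma>' "r + 2"] that by (simp add: numeral_3_eq_3)
  have 2: "upd \<sigma>' b ys b = ys ! 0" if "length ys \<ge> 2" for ys \<sigma>' b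
    using upd_inside[of 0 ys \<sigma>' b] that by (cases ys) (simp_all del: upd_inside)
  have inner: "sat I A (upd \<sigma> (r + 2) ys) (exs (r + 2 + n) n (Conj (Atom T (Var v # var_block (r + 2 + n) n))
            (Eq (Var (r + 2 + n)) (Var (r + 3)))))
      \<longleftrightarrow> (\<exists>ys'. (T, \<sigma> v # ys') \<in> I \<and> ys' ! 0 = ys ! 1)" (is "?L = ?R") if "length ys = n" for ys
  proof -
    have "?L \<longleftrightarrow> (\<exists>ys'. length ys' = n \<and> set ys' \<subseteq> A \<and> (T, \<sigma> v # ys') \<in> I \<and> ys' ! 0 = ys ! 1)"
      unfolding sat_exs using v n that by (intro ex_cong1) (auto simp: 1 2 simp del: add_2_eq_Suc add_2_eq_Suc')
    also have "\<dots> \<longleftrightarrow> ?R"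
      using I by (auto simp: in_range_def)
    finally show ?thesis .
  qed
  have "sat I A \<sigma> (complete_fo T n r v) \<longleftrightarrow>
      (\<exists>ys. length ys = n \<and> set ys \<subseteq> A \<and> (T, \<sigma> v # ys) \<in> I) \<and>
      \<not> (\<exists>ys. length ys = n \<and> set ys \<subseteq> A \<and> (T, \<sigma> v # ys) \<in> I \<and>
           \<not> (\<exists>ys'. (T, \<sigma> v # ys') \<in> I \<and> ys' ! 0 = ys ! 1))"
    unfolding complete_fo_def sat.simps sat_exs[of _ _ _ "r + 2"] using v
    by (intro conj_cong arg_cong[where f = Not] ex_cong1 refl)
       (simp_all add: inner del: add_2_eq_Suc add_2_eq_Suc')
  also have "\<dots> \<longleftrightarrow> complete_key T I (\<sigma> v)"
    using I unfolding complete_key_def in_range_def by blast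
  finally show ?thesis .
qed

lemma fv_complete_fo: "v < r + 2 \<Longrightarrow> n \<ge> 2 \<Longrightarrow> fv (complete_fo T n r v) = {v}"
  by (auto simp: complete_fo_def)

lemma rels_complete_fo [simp]: "rels (complete_fo T n r v) = {T}"
  by (simp add: complete_fo_def)

lemma sat_unique_fo:
  assumes I: "in_range T n A I" and n: "n \<ge> 2"
  shows "sat I A \<sigma> (unique_fo T n r) \<longleftrightarrow> unique_key T I (\<sigma> r)"
proof -
  \<comment> \<open>Rival keys are quantified over \<open>A\<close> only; none is missed, because a
    complete key occurs in a fact.\<close>
  have "z' \<in> A" if "complete_key T I z'" for z'
    using that I by (auto simp: complete_key_def in_range_def)
  moreover have "sat I A \<sigma> (unique_fo T n r) \<longleftrightarrow> complete_key T I (\<sigma> r) \<and>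
      \<not> (\<exists>z'\<in>A. complete_key T I z' \<and> z' \<noteq> \<sigma> r)"
    using sat_complete_fo[OF I _ n, of _ r] by (simp add: unique_fo_def)
  ultimately show ?thesis
    unfolding unique_key_def by blast
qed

lemma fv_unique_fo: "n \<ge> 2 \<Longrightarrow> fv (unique_fo T n r) = {r}"
  by (auto simp: unique_fo_def fv_complete_fo)

lemma rels_unique_fo [simp]: "rels (unique_fo T n r) = {T}"
  by (simp add: unique_fo_def)

text \<open>The first two columns of a \<open>T\<close>-fact after the key are a cyclic index and its successor; they are
  followed by \<open>K\<close> slots of width \<open>r + 1\<close>, each consisting of a relation code and a padded tuple.\<close>

definition width :: "nat \<Rightarrow> nat \<Rightarrow> nat" where "width K r = 2 + K * (r + 1)"

definition in_slot :: "nat \<Rightarrow> nat \<Rightarrow> rel \<Rightarrow> univ list \<Rightarrow> univ list \<Rightarrow> bool" where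
  "in_slot r k R us ys \<longleftrightarrow> ys ! (2 + k * (r + 1)) = to_nat R \<and>
     (\<forall>i<arity R. ys ! (2 + k * (r + 1) + Suc i) = us ! i)"

definition slot_fo :: "nat \<Rightarrow> nat \<Rightarrow> rel \<Rightarrow> fo" where
  "slot_fo r k R = Conj (Eq (Var (r + 2 + (2 + k * (r + 1)))) (Cst (to_nat R)))
     (Conjs (map (\<lambda>i. Eq (Var (r + 2 + (2 + k * (r + 1) + Suc i))) (Var i)) [0..<arity R]))"

definition block_fo :: "rel \<Rightarrow> nat \<Rightarrow> nat \<Rightarrow> rel \<Rightarrow> fo" where
  "block_fo T K r R = Ex r (Conj (unique_fo T (width K r) r)
     (exs (r + 2) (width K r) (Conj (Atom T (Var r # var_block (r + 2) (width K r)))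
        (Disjs (map (\<lambda>k. slot_fo r k R) [0..<K])))))"

lemma slot_in_width:
  assumes "k < K" "i \<le> r"
  shows "2 + k * (r + 1) + i < width K r"
proof -
  have "k * (r + 1) + i < Suc k * (r + 1)"
    using assms by simp
  also have "\<dots> \<le> K * (r + 1)"
    using assms by (intro mult_right_mono) auto
  finally show ?thesis by (simp add: width_def)
qed

lemma sat_slot_fo:
  assumes "k < K" "length ys = width K r" "arity R \<le> r" "\<And>i. i < arity R \<Longrightarrow> \<sigma> i = us ! i"
  shows "sat I A (upd \<sigma> (r + 2) ys) (slot_fo r k R) \<longleftrightarrow> in_slot r k R us ys"
proof -
  have at: "upd \<sigma> (r + 2) ys (r + 2 + (2 + k * (r + 1) + i)) = ys ! (2 + k * (r + 1) + i)"
    if "i \<le> r" for i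
    using slot_in_width[OF assms(1) that] assms(2) by (intro upd_inside) auto
  have code: "upd \<sigma> (r + 2) ys (r + 2 + (2 + k * (r + 1))) = ys ! (2 + k * (r + 1))"
    using at[of 0] by simp
  have "upd \<sigma> (r + 2) ys (r + 2 + (2 + k * (r + 1) + Suc i)) = upd \<sigma> (r + 2) ys i \<longleftrightarrow>
      ys ! (2 + k * (r + 1) + Suc i) = us ! i" if "i < arity R" for i
    using that assms by (subst at) simp_all
  then show ?thesis
    unfolding slot_fo_def in_slot_def sat.simps tval.simps code sat_Conjs set_map ball_simps set_upt
    by (intro conj_cong refl) auto
qed

lemma sat_block_fo:
  assumes I: "in_range T (width K r) A I" and R: "arity R \<le> r"
    and \<sigma>: "\<And>i. i < arity R \<Longrightarrow> \<sigma> i = us ! i"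
  shows "sat I A \<sigma> (block_fo T K r R) \<longleftrightarrow>
    (\<exists>z ys. unique_key T I z \<and> (T, z # ys) \<in> I \<and> (\<exists>k<K. in_slot r k R us ys))"
proof -
  have inner: "sat I A (\<sigma>(r := z)) (exs (r + 2) (width K r)
      (Conj (Atom T (Var r # var_block (r + 2) (width K r)))
        (Disjs (map (\<lambda>k. slot_fo r k R) [0..<K])))) \<longleftrightarrow>
    (\<exists>ys. (T, z # ys) \<in> I \<and> (\<exists>k<K. in_slot r k R us ys))" (is "?L \<longleftrightarrow> ?R") for z
  proof -
    have "?L \<longleftrightarrow> (\<exists>ys. length ys = width K r \<and> set ys \<subseteq> A \<and> (T, z # ys) \<in> I \<and>
       (\<exists>k<K. in_slot r k R us ys))"
      unfolding sat_exs using R \<sigma> sat_slot_fo[of _ K _ r R "\<sigma>(r := z)" us]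
      by (intro ex_cong1) (auto simp: Bex_def)
    also have "\<dots> \<longleftrightarrow> ?R"
      using I by (auto simp: in_range_def)
    finally show ?thesis .
  qed
  have "z \<in> A" if "(T, z # ys) \<in> I" for z ys
    using I that by (auto simp: in_range_def)
  moreover have "sat I A (\<sigma>(r := z)) (unique_fo T (width K r) r) = unique_key T I z" for z
    using I by (simp add: sat_unique_fo width_def)
  ultimately show ?thesis
    using inner by (auto simp: block_fo_def simp del: add_2_eq_Suc add_2_eq_Suc' fun_upd_apply)
qed

lemma fv_block_fo:
  assumes R: "arity R \<le> r"
  shows "fv (block_fo T K r R) \<subseteq> {..<arity R}"
proof -
  have slot: "fv (slot_fo r k R) \<subseteq> {..<arity R} \<union> {r + 2..<r + 2 + width K r}" if "k < K" for k
  proof -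
    have "r + 2 + (2 + k * (r + 1) + i) \<in> {r + 2..<r + 2 + width K r}" if "i \<le> r" for i
      using slot_in_width[OF \<open>k < K\<close> that] by (simp del: mult_Suc_right)
    from this[of 0] this[of "Suc _"] R show ?thesis
      unfolding slot_fo_def by (auto simp del: mult_Suc_right)
  qed
  let ?Y = "{r + 2..<r + 2 + width K r}"
  have "fv (block_fo T K r R) \<subseteq> insert r (insert r ?Y \<union> (\<Union>k<K. fv (slot_fo r k R)) - ?Y) - {r}"
    by (auto simp: block_fo_def fv_unique_fo width_def)
  also have "\<dots> \<subseteq> {..<arity R}"
    using slot by blast
  finally show ?thesis .
qed

lemma rels_block_fo: "rels (block_fo T K r R) \<subseteq> {T}"
  by (auto simp: block_fo_def slot_fo_def)

section \<open>Coins and the choice of a default instance\<close>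

definition accept :: fact where "accept = ((2, 0), [])"

text \<open>One unary symbol serves all selection coins, which formulas tell apart by constants. The
  names \<open>1\<close> and \<open>2\<close> keep coins and acceptance distinct from the block
  facts, whose relation will have the name \<open>0\<close>.\<close>

definition coin :: "nat \<Rightarrow> fact" where "coin i = ((1, 1), [i])"

definition accept_fo :: fo where "accept_fo = Atom (2, 0) []"

definition coin_fo :: "nat \<Rightarrow> fo" where "coin_fo i = Atom (1, 1) [Cst i]"

lemma sat_accept_fo [simp]: "sat I A \<sigma> accept_fo \<longleftrightarrow> accept \<in> I"
  by (simp add: accept_fo_def accept_def)

lemma sat_coin_fo [simp]: "sat I A \<sigma> (coin_fo i) \<longleftrightarrow> coin i \<in> I"
  by (simp add: coin_fo_def coin_def)

text \<open>The index of the first coin present, with \<open>m\<close> as the fallback when no coin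
  below \<open>m\<close> is present; hence exactly one index is chosen in every instance.\<close>

definition chosen :: "nat \<Rightarrow> inst \<Rightarrow> nat \<Rightarrow> bool" where
  "chosen m I i \<longleftrightarrow> i \<le> m \<and> (i < m \<longrightarrow> coin i \<in> I) \<and> (\<forall>j<i. coin j \<notin> I)"

lemma chosen_exists: "\<exists>i. chosen m I i"
proof
  define i where "i = (LEAST i. i = m \<or> coin i \<in> I)"
  have "i = m \<or> coin i \<in> I"
    unfolding i_def by (rule LeastI[of _ m]) simp
  moreover have "i \<le> m"
    unfolding i_def by (rule Least_le) simp
  moreover have "coin j \<notin> I" if "j < i" for j
    using not_less_Least[of j "\<lambda>i. i = m \<or> coin i \<in> I"] that by (simp add: i_def)
  ultimately show "chosen m I i"
    by (auto simp: chosen_def)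
qed

lemma chosen_unique:
  assumes "chosen m I i" "chosen m I j"
  shows "i = j"
proof -
  have "\<not> i < j" if "chosen m I i" "chosen m I j" for i j
    using that by (auto simp: chosen_def)
  with assms show ?thesis
    by (meson linorder_neqE_nat)
qed

definition chosen_fo :: "nat \<Rightarrow> nat \<Rightarrow> fo" where
  "chosen_fo m i = Conj (if i < m then coin_fo i else fo_True) (Conjs (map (\<lambda>j. Neg (coin_fo j)) [0..<i]))"

lemma sat_chosen_fo: "i \<le> m \<Longrightarrow> sat I A \<sigma> (chosen_fo m i) \<longleftrightarrow> chosen m I i"
  by (auto simp: chosen_fo_def chosen_def fo_True_def)

section \<open>The default output and the complete view\<close>

definition tuple_fo :: "univ list \<Rightarrow> fo" where
  "tuple_fo us = Conjs (map (\<lambda>i. Eq (Var i) (Cst (us ! i))) [0..<length us])"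

definition tuples :: "rel \<Rightarrow> inst \<Rightarrow> univ list list" where
  "tuples R D = (SOME uss. set uss = {us. (R, us) \<in> D})"

lemma set_tuples: "finite D \<Longrightarrow> set (tuples R D) = {us. (R, us) \<in> D}"
proof -
  assume "finite D"
  then have "finite {us. (R, us) \<in> D}"
    by (rule finite_subset[rotated, OF finite_imageI[where h = snd]]) force
  then show ?thesis
    unfolding tuples_def by (rule someI_ex[OF finite_list])
qed

definition default_fo :: "inst list \<Rightarrow> rel \<Rightarrow> fo" where
  "default_fo Fs R = Disjs (map (\<lambda>i. Conj (chosen_fo (length Fs - 1) i)
      (Disjs (map tuple_fo (tuples R (Fs ! i))))) [0..<length Fs])"

text \<open>The two disjuncts exclude each other, since \<open>block_fo\<close> itself demands a
  unique complete key.\<close>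

definition view_fo :: "rel \<Rightarrow> nat \<Rightarrow> nat \<Rightarrow> inst list \<Rightarrow> rel \<Rightarrow> fo" where
  "view_fo T K r Fs R = Disjs [Conj accept_fo (block_fo T K r R),
     Conj (Neg (Conj accept_fo (Ex r (unique_fo T (width K r) r)))) (default_fo Fs R)]"

lemma FO_view_view_fo:
  assumes S: "schema S" and r: "\<And>R. R \<in> S \<Longrightarrow> arity R \<le> r"
    and Fs: "\<And>D. D \<in> set Fs \<Longrightarrow> is_instance S D"
  shows "FO_view {T, (1, 1), (2, 0)} S (view_fo T K r Fs)"
  unfolding FO_view_def
proof (intro conjI ballI)
  fix R assume R: "R \<in> S"
  have len: "length us = arity R" if "us \<in> set (tuples R (Fs ! i))" "i < length Fs" for us i
    using that Fs[of "Fs ! i"] by (auto simp: is_instance_def facts_over_def set_tuples)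
  have "fv (default_fo Fs R) \<subseteq> {..<arity R}"
    by (auto simp: default_fo_def chosen_fo_def coin_fo_def tuple_fo_def fo_True_def len split: if_splits)
  then show "fv (view_fo T K r Fs R) \<subseteq> {..<arity R}"
    using fv_block_fo[OF r[OF R], of T K]
    by (auto simp: view_fo_def accept_fo_def fv_unique_fo width_def)
  have "rels (default_fo Fs R) \<subseteq> {(1, 1)}"
    by (auto simp: default_fo_def chosen_fo_def coin_fo_def tuple_fo_def fo_True_def split: if_splits)
  then show "rels (view_fo T K r Fs R) \<subseteq> {T, (1, 1), (2, 0)}"
    using rels_block_fo[of T K r R] by (auto simp: view_fo_def accept_fo_def)
qed (use S in simp)

lemma sat_default_fo:
  assumes Fs: "\<And>D. D \<in> set Fs \<Longrightarrow> is_instance S D" and us: "length us = arity R"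
    and i: "chosen (length Fs - 1) I i" "Fs \<noteq> []"
  shows "sat I A (tuple_assign us) (default_fo Fs R) \<longleftrightarrow> (R, us) \<in> Fs ! i"
proof -
  have i': "i < length Fs"
    using i by (cases Fs) (auto simp: chosen_def)
  have tuple: "sat I A (tuple_assign us) (tuple_fo us') \<longleftrightarrow> us = us'" if "length us' = arity R" for us'
    using that us by (auto simp: tuple_fo_def tuple_assign_def list_eq_iff_nth_eq)
  have D: "set (tuples R (Fs ! j)) = {us. (R, us) \<in> Fs ! j}"
      "\<And>us. (R, us) \<in> Fs ! j \<Longrightarrow> length us = arity R" if "j < length Fs" for j
    using that Fs[of "Fs ! j"] by (auto simp: is_instance_def facts_over_def set_tuples)
  have "sat I A (tuple_assign us) (default_fo Fs R) \<longleftrightarrow>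
      (\<exists>j<length Fs. chosen (length Fs - 1) I j \<and> (\<exists>us'. (R, us') \<in> Fs ! j \<and> us = us'))"
    by (auto simp: default_fo_def sat_chosen_fo D(1) tuple D(2))
  then show ?thesis
    using i i' chosen_unique by blast
qed

text \<open>Output tuples range over the active domain and the constants of the formula. The tuples
  of a default instance need not lie over the active domain, but they do consist of
  constants.\<close>

lemma fo_consts_default_fo:
  assumes "D \<in> set Fs" "finite D" "(R, us) \<in> D"
  shows "set us \<subseteq> fo_consts (default_fo Fs R)"
proof -
  obtain i where i: "i < length Fs" "Fs ! i = D"
    using assms by (auto simp: in_set_conv_nth)
  have "us ! j \<in> fo_consts (tuple_fo us)" if "j < length us" for j
    using that by (auto simp: tuple_fo_def fo_consts_Conjs)
  then have "set us \<subseteq> fo_consts (tuple_fo us)"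
    by (metis in_set_conv_nth subsetI)
  also have "\<dots> \<subseteq> fo_consts (Disjs (map tuple_fo (tuples R (Fs ! i))))"
    using i assms by (auto simp: fo_consts_Disjs set_tuples)
  also have "\<dots> \<subseteq> fo_consts (default_fo Fs R)"
    using i by (auto simp: default_fo_def fo_consts_Disjs[of "map _ [0..<length Fs]"])
  finally show ?thesis .
qed

lemma apply_view_view_fo:
  assumes I: "\<And>z us. (T, us) \<in> I \<Longrightarrow> length us = Suc (width K r)"
    and r: "\<And>R. R \<in> S \<Longrightarrow> arity R \<le> r"
    and Fs: "Fs \<noteq> []" "\<And>D. D \<in> set Fs \<Longrightarrow> is_instance S D"
    and i: "chosen (length Fs - 1) I i"
  shows "apply_view S (view_fo T K r Fs) I =
    (if accept \<in> I \<and> (\<exists>z. unique_key T I z)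
     then {(R, us). R \<in> S \<and> length us = arity R \<and>
            (\<exists>z ys. unique_key T I z \<and> (T, z # ys) \<in> I \<and> (\<exists>k<K. in_slot r k R us ys))}
     else Fs ! i)"
proof -
  have range: "in_range T (width K r) A I" if "adom I \<subseteq> A" for A
    unfolding in_range_def
  proof (intro allI impI)
    fix z ys assume f: "(T, z # ys) \<in> I"
    then have "set (z # ys) \<subseteq> adom I"
      by (force simp: adom_def)
    then show "length ys = width K r \<and> z \<in> A \<and> set ys \<subseteq> A"
      using I[OF f] that by auto
  qed
  have i': "Fs ! i \<in> set Fs"
    using i Fs(1) by (intro nth_mem) (cases Fs, auto simp: chosen_def)
  \<comment> \<open>A tuple decoded from a slot is copied from columns of a fact in
    \<open>I\<close>, so the domain restriction of the view does not remove it.\<close>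
  have slot: "set us \<subseteq> adom I" if "(T, z # ys) \<in> I" "k < K" "in_slot r k R us ys"
      "R \<in> S" "length us = arity R" for z ys k R us
  proof -
    have "us ! j \<in> set ys" if "j < length us" for j
    proof -
      have "2 + k * (r + 1) + Suc j < length ys"
        using slot_in_width[OF \<open>k < K\<close>, of "Suc j" r] I[OF \<open>(T, z # ys) \<in> I\<close>] r[OF \<open>R \<in> S\<close>]
          that \<open>length us = arity R\<close> by simp
      moreover have "us ! j = ys ! (2 + k * (r + 1) + Suc j)"
        using \<open>in_slot r k R us ys\<close> that \<open>length us = arity R\<close> unfolding in_slot_def by simp
      ultimately show ?thesis
        by (metis nth_mem)
    qed
    then have "set us \<subseteq> set (z # ys)"
      by (metis in_set_conv_nth set_subset_Cons subsetI subset_trans)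
    then show ?thesis
      using \<open>(T, z # ys) \<in> I\<close> by (force simp: adom_def)
  qed
  have key_in: "z \<in> adom I" if "unique_key T I z" for z
    using that by (force simp: unique_key_def complete_key_def adom_def)
  have sat: "sat I A (tuple_assign us) (view_fo T K r Fs R) \<longleftrightarrow>
      (if accept \<in> I \<and> (\<exists>z. unique_key T I z)
       then \<exists>z ys. unique_key T I z \<and> (T, z # ys) \<in> I \<and> (\<exists>k<K. in_slot r k R us ys)
       else (R, us) \<in> Fs ! i)" if "R \<in> S" "length us = arity R" "adom I \<subseteq> A" for A R us
  proof -
    have "sat I A (tuple_assign us) (block_fo T K r R) \<longleftrightarrow>
        (\<exists>z ys. unique_key T I z \<and> (T, z # ys) \<in> I \<and> (\<exists>k<K. in_slot r k R us ys))"
      using that by (intro sat_block_fo range r) (auto simp: tuple_assign_def)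
    moreover have "sat I A (tuple_assign us) (default_fo Fs R) \<longleftrightarrow> (R, us) \<in> Fs ! i"
      using that i Fs by (intro sat_default_fo)
    moreover have "sat I A (tuple_assign us) (Ex r (unique_fo T (width K r) r)) \<longleftrightarrow> (\<exists>z. unique_key T I z)"
      using key_in that range[OF that(3)] by (auto simp: sat_unique_fo width_def)
    ultimately show ?thesis
      by (auto simp: view_fo_def simp del: sat.simps(5))
  qed
  have const_in: "set us \<subseteq> fo_consts (view_fo T K r Fs R)" if "(R, us) \<in> Fs ! i" for R us
    using fo_consts_default_fo[OF i' _ that] Fs(2)[OF i']
    by (auto simp: view_fo_def fo_consts_Disjs is_instance_def)
  have Fi: "R \<in> S \<and> length us = arity R" if "(R, us) \<in> Fs ! i" for R us
    using Fs(2)[OF i'] that by (auto simp: is_instance_def facts_over_def)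
  have "(R, us) \<in> apply_view S (view_fo T K r Fs) I \<longleftrightarrow> (R, us) \<in> (if accept \<in> I \<and> (\<exists>z. unique_key T I z)
     then {(R, us). R \<in> S \<and> length us = arity R \<and>
            (\<exists>z ys. unique_key T I z \<and> (T, z # ys) \<in> I \<and> (\<exists>k<K. in_slot r k R us ys))}
     else Fs ! i)" (is "?L \<longleftrightarrow> ?R") for R us
  proof -
    have L: "?L \<longleftrightarrow> R \<in> S \<and> length us = arity R \<and> set us \<subseteq> adom I \<union> fo_consts (view_fo T K r Fs R) \<and>
      (if accept \<in> I \<and> (\<exists>z. unique_key T I z)
       then \<exists>z ys. unique_key T I z \<and> (T, z # ys) \<in> I \<and> (\<exists>k<K. in_slot r k R us ys)
       else (R, us) \<in> Fs ! i)"
      unfolding apply_view_def mem_Collect_eq case_prod_conv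
      by (intro conj_cong refl sat) auto
    show ?thesis
    proof (cases "accept \<in> I \<and> (\<exists>z. unique_key T I z)")
      case True
      show ?thesis
        unfolding L if_P[OF True] mem_Collect_eq case_prod_conv using slot[of _ _ _ R us] by blast
    next
      case False
      show ?thesis
        unfolding L if_not_P[OF False] using const_in[of R us] Fi[of R us] by blast
    qed
  qed
  then show ?thesis
    by (intro set_eqI) (simp only: split_paired_all)
qed

section \<open>Encoding instances as blocks of facts\<close>

locale block_encoding =
  fixes S :: "rel set" and c r :: nat and B :: "inst set"
  assumes c_pos: "c > 0"
    and arity_le: "\<And>R. R \<in> S \<Longrightarrow> arity R \<le> r"
    and countable_B: "countable B"
    and instance_B: "\<And>D. D \<in> B \<Longrightarrow> is_instance S D"
    and empty_notin_B: "{} \<notin> B"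
begin

abbreviation slots :: nat where "slots \<equiv> 2 * c"

abbreviation T :: rel where "T \<equiv> (0, Suc (width slots r))"

text \<open>The number of facts encoding \<open>D\<close>. Rounding \<open>card D / c\<close> down makes the marginal
  probabilities small enough, and is compensated for by having \<open>2 * c\<close> rather than \<open>c\<close> slots.\<close>

definition parts :: "inst \<Rightarrow> nat" where "parts D = max 1 (card D div c)"

definition elems :: "inst \<Rightarrow> fact list" where
  "elems D = (SOME fs. set fs = D \<and> distinct fs)"

text \<open>The slots run cyclically through \<open>D\<close>, so surplus slots repeat facts of
  \<open>D\<close> and no marker for empty slots arises. The wrap-around presupposes that
  \<open>D\<close> is nonempty.\<close>

definition entry :: "inst \<Rightarrow> nat \<Rightarrow> nat \<Rightarrow> fact" where
  "entry D j k = elems D ! ((j * slots + k) mod card D)"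

definition slot :: "fact \<Rightarrow> univ list" where
  "slot f = to_nat (fst f) # snd f @ replicate (r - length (snd f)) 0"

definition cells :: "inst \<Rightarrow> nat \<Rightarrow> univ list" where
  "cells D j = j # (Suc j mod parts D) #
     map (\<lambda>x. slot (entry D j (x div (r + 1))) ! (x mod (r + 1))) [0..<slots * (r + 1)]"

definition key :: "inst \<Rightarrow> univ" where "key = to_nat_on B"

definition part :: "inst \<Rightarrow> nat \<Rightarrow> fact" where
  "part D j = (T, key D # cells D j)"

definition block :: "inst \<Rightarrow> fact set" where
  "block D = part D ` {..<parts D}"

definition full :: "inst \<Rightarrow> inst \<Rightarrow> bool" where
  "full I D \<longleftrightarrow> D \<in> B \<and> block D \<subseteq> I"

definition only_full :: "inst \<Rightarrow> inst \<Rightarrow> bool" where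
  "only_full I D \<longleftrightarrow> full I D \<and> (\<forall>D'. full I D' \<longrightarrow> D' = D)"

lemma parts_pos: "parts D > 0"
  by (simp add: parts_def)

lemma key_inj: "D \<in> B \<Longrightarrow> D' \<in> B \<Longrightarrow> key D = key D' \<longleftrightarrow> D = D'"
  using countable_B by (simp add: key_def)

lemma part_inj: "D \<in> B \<Longrightarrow> D' \<in> B \<Longrightarrow> part D j = part D' j' \<longleftrightarrow> D = D' \<and> j = j'"
  using key_inj by (auto simp: part_def cells_def)

lemma card_pos: "D \<in> B \<Longrightarrow> card D > 0"
  using instance_B[of D] empty_notin_B by (auto simp: is_instance_def card_gt_0_iff)

lemma elems:
  assumes "D \<in> B"
  shows "set (elems D) = D" "length (elems D) = card D"
proof -
  have "\<exists>fs. set fs = D \<and> distinct fs"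
    using instance_B[OF assms] by (auto simp: is_instance_def finite_distinct_list)
  then have "set (elems D) = D \<and> distinct (elems D)"
    unfolding elems_def by (rule someI_ex)
  then show "set (elems D) = D" "length (elems D) = card D"
    by (auto simp flip: distinct_card)
qed

lemma entry_in:
  assumes "D \<in> B"
  shows "entry D j k \<in> D"
proof -
  have "(j * slots + k) mod card D < length (elems D)"
    using card_pos[OF assms] elems[OF assms] by simp
  then show ?thesis
    using elems(1)[OF assms] unfolding entry_def by (metis nth_mem)
qed

lemma entries_cover:
  assumes D: "D \<in> B" and f: "f \<in> D"
  obtains j k where "j < parts D" "k < slots" "entry D j k = f"
proof -
  obtain x where x: "x < card D" "elems D ! x = f"
    using elems[OF D] f by (metis in_set_conv_nth)
  have "card D < (card D div c + 1) * c"
    using c_pos by (metis Suc_eq_plus1 dividend_less_div_times mult.commute mult_Suc)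
  also have "\<dots> \<le> parts D * slots"
  proof -
    \<comment> \<open>Adding 1 at most doubles a positive quotient, and for quotient 0 there is one
      part. This is where twice \<open>c\<close> slots make up for rounding down.\<close>
    have "card D div c + 1 \<le> 2 * parts D"
      by (simp add: parts_def)
    then have "(card D div c + 1) * c \<le> 2 * parts D * c"
      by (rule mult_right_mono) simp
    then show ?thesis by (simp add: mult_ac)
  qed
  \<comment> \<open>The fact at position \<open>x\<close> is stored in part
    \<open>x div slots\<close>, slot \<open>x mod slots\<close>.\<close>
  finally have "x div slots < parts D"
    using x(1) by (intro less_mult_imp_div_less) simp
  moreover have "x mod slots < slots"
    using c_pos by simp
  moreover have "entry D (x div slots) (x mod slots) = f"
    unfolding entry_def div_mult_mod_eq using x by simp
  ultimately show ?thesis by (rule that)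
qed

lemma length_cells: "length (cells D j) = width slots r"
  by (simp add: cells_def width_def)

lemma nth_cells:
  assumes "k < slots" "i \<le> r"
  shows "cells D j ! (2 + k * (r + 1) + i) = slot (entry D j k) ! i"
proof -
  let ?x = "k * (r + 1) + i"
  let ?f = "\<lambda>x. slot (entry D j (x div (r + 1))) ! (x mod (r + 1))"
  have x: "?x < slots * (r + 1)"
    using slot_in_width[OF assms] by (simp add: width_def)
  have div: "?x div (r + 1) = k" "?x mod (r + 1) = i"
    using assms by (subst add.commute, subst div_mult_self1; simp)
      (use assms in \<open>subst add.commute, subst mod_mult_self1, simp\<close>)
  have "cells D j ! (2 + ?x) = map ?f [0..<slots * (r + 1)] ! ?x"
    by (simp add: cells_def del: mult_Suc_right)
  also have "\<dots> = ?f ?x"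
    using x by (subst nth_map) (simp_all del: mult_Suc_right)
  also have "\<dots> = slot (entry D j k) ! i"
    unfolding div ..
  finally show ?thesis
    by (simp only: add.assoc)
qed

text \<open>Equal codes mean equal relation symbols, hence equal arities, so comparing the first
  \<open>arity R\<close> positions decides equality of the tuples and the padding is never
  read.\<close>

lemma in_slot_cells:
  assumes D: "D \<in> B" and k: "k < slots" and R: "R \<in> S" and us: "length us = arity R"
  shows "in_slot r k R us (cells D j) \<longleftrightarrow> entry D j k = (R, us)"
proof -
  obtain R' us' where f: "entry D j k = (R', us')"
    by (cases "entry D j k")
  then have len: "length us' = arity R'"
    using entry_in[OF D, of j k] instance_B[OF D] by (auto simp: is_instance_def facts_over_def)
  have "in_slot r k R us (cells D j) \<longleftrightarrow> to_nat R' = to_nat R \<and>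
      (\<forall>i<arity R. slot (R', us') ! Suc i = us ! i)"
    using nth_cells[OF k, of 0 D j] nth_cells[OF k, of "Suc _" D j] arity_le[OF R]
    unfolding in_slot_def f by (auto simp: slot_def)
  also have "\<dots> \<longleftrightarrow> R' = R \<and> us' = us"
    using len us by (auto simp: slot_def nth_append list_eq_iff_nth_eq)
  finally show ?thesis
    by (simp add: f)
qed

section \<open>Complete keys and full blocks\<close>

lemma part_closed_imp_full:
  assumes "j < parts D" "part D j \<in> I"
    and closed: "\<And>j. j < parts D \<Longrightarrow> part D j \<in> I \<Longrightarrow> part D (Suc j mod parts D) \<in> I"
  shows "block D \<subseteq> I"
proof -
  have *: "part D ((j + i) mod parts D) \<in> I" for i
  proof (induction i)
    case (Suc i)
    then show ?case
      using closed[of "(j + i) mod parts D"] parts_pos[of D] by (simp add: mod_Suc_eq)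
  qed (use assms in simp)
  have "part D j' \<in> I" if "j' < parts D" for j'
    \<comment> \<open>From index \<open>j\<close>, \<open>parts D - j\<close> steps lead around the
      cycle to index 0, and \<open>j'\<close> further steps to \<open>j'\<close>.\<close>
    using *[of "parts D - j + j'"] that assms(1) by simp
  then show ?thesis
    by (auto simp: block_def)
qed

text \<open>As every \<open>T\<close>-fact of \<open>I\<close> belongs to some block, facts with a
  common key are parts of one instance and are determined by their index. Closure under successors
  then forces the whole cycle to be present.\<close>

lemma complete_key_iff_full:
  assumes I: "\<And>us. (T, us) \<in> I \<Longrightarrow> (T, us) \<in> (\<Union>D\<in>B. block D)"
  shows "complete_key T I z \<longleftrightarrow> (\<exists>D. full I D \<and> z = key D)"
proof
  assume z: "complete_key T I z"
  then obtain ys where ys: "(T, z # ys) \<in> I"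
    by (auto simp: complete_key_def)
  then obtain D j where D: "D \<in> B" "j < parts D" "z = key D" "ys = cells D j"
    using I[OF ys] by (auto simp: block_def part_def)
  have "part D (Suc j mod parts D) \<in> I" if j: "j < parts D" "part D j \<in> I" for j
  proof -
    obtain ys' where ys': "(T, z # ys') \<in> I" "ys' ! 0 = cells D j ! 1"
      using z j D(3) unfolding complete_key_def part_def by blast
    then obtain D' j' where D': "D' \<in> B" "z = key D'" "ys' = cells D' j'"
      using I[OF ys'(1)] by (auto simp: block_def part_def)
    then have "D' = D"
      using D key_inj by blast
    moreover have "j' = Suc j mod parts D"
      using ys'(2) D' by (simp add: cells_def)
    ultimately show ?thesis
      using ys'(1) D' by (simp add: part_def)
  qed
  then have "block D \<subseteq> I"
    using part_closed_imp_full[of j D I] ys D by (simp add: part_def)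
  then show "\<exists>D. full I D \<and> z = key D"
    using D by (auto simp: full_def)
next
  assume "\<exists>D. full I D \<and> z = key D"
  then obtain D where D: "D \<in> B" "block D \<subseteq> I" "z = key D"
    by (auto simp: full_def)
  have part: "(T, key D # cells D j) \<in> I" if "j < parts D" for j
    using D(2) that by (auto simp: block_def part_def)
  show "complete_key T I z"
    unfolding complete_key_def
  proof (intro conjI allI impI)
    show "\<exists>ys. (T, z # ys) \<in> I"
      using part parts_pos D(3) by blast
    fix ys assume ys: "(T, z # ys) \<in> I"
    then obtain D' j where D': "D' \<in> B" "z = key D'" "ys = cells D' j"
      using I[OF ys] by (auto simp: block_def part_def)
    then have "ys = cells D j"
      using D key_inj by metis
    then show "\<exists>ys'. (T, z # ys') \<in> I \<and> ys' ! 0 = ys ! 1"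
      using part[of "Suc j mod parts D"] parts_pos[of D] D(3)
      by (intro exI[of _ "cells D (Suc j mod parts D)"]) (auto simp: cells_def)
  qed
qed

lemma unique_key_iff_only_full:
  assumes "\<And>us. (T, us) \<in> I \<Longrightarrow> (T, us) \<in> (\<Union>D\<in>B. block D)"
  shows "unique_key T I z \<longleftrightarrow> (\<exists>D. only_full I D \<and> z = key D)"
proof -
  have complete: "complete_key T I z \<longleftrightarrow> (\<exists>D. full I D \<and> z = key D)" for z
    using assms by (rule complete_key_iff_full)
  have inj: "D' = D" if "full I D" "full I D'" "key D' = key D" for D D'
    using that key_inj by (auto simp: full_def)
  show ?thesis
  proof
    assume z: "unique_key T I z"
    then obtain D where D: "full I D" "z = key D"
      by (auto simp: unique_key_def complete)
    have "D' = D" if "full I D'" for D'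
    proof -
      have "key D' = key D"
        using z that D(2) complete unfolding unique_key_def by metis
      then show ?thesis
        using inj D(1) that by blast
    qed
    then have "only_full I D"
      unfolding only_full_def using D(1) by blast
    with D show "\<exists>D. only_full I D \<and> z = key D"
      by blast
  qed (auto simp: unique_key_def only_full_def complete)
qed

lemma apply_view_encoding:
  assumes I: "\<And>us. (T, us) \<in> I \<Longrightarrow> (T, us) \<in> (\<Union>D\<in>B. block D)"
    and Fs: "Fs \<noteq> []" "\<And>D. D \<in> set Fs \<Longrightarrow> is_instance S D"
  shows "accept \<in> I \<Longrightarrow> only_full I D \<Longrightarrow> apply_view S (view_fo T slots r Fs) I = D"
    and "\<not> (accept \<in> I \<and> (\<exists>D. only_full I D)) \<Longrightarrow> chosen (length Fs - 1) I i \<Longrightarrow>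
      apply_view S (view_fo T slots r Fs) I = Fs ! i"
proof -
  have len: "length us = Suc (width slots r)" if "(T, us) \<in> I" for us
    using I[OF that] length_cells by (auto simp: block_def part_def)
  have unique: "unique_key T I z \<longleftrightarrow> (\<exists>D. only_full I D \<and> z = key D)" for z
    using I by (rule unique_key_iff_only_full)
  note view = apply_view_view_fo[where I = I and T = T and K = slots, OF len arity_le Fs]
  show "apply_view S (view_fo T slots r Fs) I = Fs ! i"
    if "\<not> (accept \<in> I \<and> (\<exists>D. only_full I D))" "chosen (length Fs - 1) I i"
  proof -
    have "\<not> (accept \<in> I \<and> (\<exists>z. unique_key T I z))"
      using that(1) unfolding unique by blast
    then show ?thesis
      by (subst view[OF _ _ _ that(2)]) (simp_all only: if_False)
  qed
  show "apply_view S (view_fo T slots r Fs) I = D" if acc: "accept \<in> I" and D: "only_full I D"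
  proof -
    obtain i where i: "chosen (length Fs - 1) I i"
      using chosen_exists by blast
    have DB: "D \<in> B" "block D \<subseteq> I"
      using D by (auto simp: only_full_def full_def)
    have uniq: "unique_key T I z \<longleftrightarrow> z = key D" for z
      unfolding unique using D by (auto simp: only_full_def)
    have facts: "(T, key D # ys) \<in> I \<longleftrightarrow> (\<exists>j<parts D. ys = cells D j)" for ys
    proof
      assume ys: "(T, key D # ys) \<in> I"
      then obtain D' j where D': "D' \<in> B" "key D = key D'" "ys = cells D' j" "j < parts D'"
        using I[OF ys] by (auto simp: block_def part_def)
      then show "\<exists>j<parts D. ys = cells D j"
        using key_inj DB(1) by blast
    qed (use DB in \<open>auto simp: block_def part_def\<close>)
    have "apply_view S (view_fo T slots r Fs) I = {(R, us). R \<in> S \<and> length us = arity R \<and>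
            (\<exists>j<parts D. \<exists>k<slots. in_slot r k R us (cells D j))}"
      using acc by (subst view[OF _ _ _ i]) (auto simp: uniq facts)
    also have "\<dots> = {(R, us). R \<in> S \<and> length us = arity R \<and>
            (\<exists>j<parts D. \<exists>k<slots. entry D j k = (R, us))}"
      using in_slot_cells[OF DB(1)] by blast
    also have "\<dots> = D"
    proof (intro set_eqI iffI)
      fix f assume f: "f \<in> D"
      obtain j k where "j < parts D" "k < slots" "entry D j k = f"
        using entries_cover[OF DB(1) f] .
      then show "f \<in> {(R, us). R \<in> S \<and> length us = arity R \<and>
            (\<exists>j<parts D. \<exists>k<slots. entry D j k = (R, us))}"
        using f instance_B[OF DB(1)] by (cases f) (auto simp: is_instance_def facts_over_def)
    qed (use entry_in[OF DB(1)] in \<open>auto; metis\<close>)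
    finally show ?thesis .
  qed
qed

end

section \<open>Probabilities of complete blocks\<close>

locale block_model = block_encoding +
  fixes P :: "inst pmf"
  assumes B_subset: "B \<subseteq> set_pmf P"
    and prob_B: "measure_pmf.prob P B < 1/4"
    and summable_B: "(\<lambda>D. real (card D) * pmf P D powr (real c / real (card D))) summable_on B"
begin

text \<open>The odds \<open>q / (1 - q)\<close> of a full block are proportional to \<open>pmf P D\<close>; the factor \<open>2\<close> leaves
  room for the blocks that spoil uniqueness, see \<open>prob_no_full\<close>.\<close>

definition block_prob :: "inst \<Rightarrow> real" where
  "block_prob D = 2 * pmf P D / (1 + 2 * pmf P D)"

definition block_index :: "(inst \<times> nat) set" where
  "block_index = Sigma B (\<lambda>D. {..<parts D})"

text \<open>All parts of \<open>D\<close> share the \<open>parts D\<close>-th root of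
  \<open>block_prob D\<close> as marginal, so that independence gives the block the probability
  \<open>block_prob D\<close>. The inverse of \<open>part\<close> recovers \<open>D\<close> from the
  fact.\<close>

definition part_prob :: "fact \<Rightarrow> real" where
  "part_prob f = (if f \<in> (\<Union>D\<in>B. block D)
     then case inv_into block_index (case_prod part) f of (D, _) \<Rightarrow> block_prob D powr (1 / real (parts D))
     else 0)"

lemma inj_part: "inj_on (case_prod part) block_index"
  using part_inj by (auto simp: inj_on_def block_index_def)

lemma UN_block: "(\<Union>D\<in>B. block D) = case_prod part ` block_index"
  by (auto simp: block_index_def block_def)

lemma part_prob_part:
  assumes "D \<in> B" "j < parts D"
  shows "part_prob (part D j) = block_prob D powr (1 / real (parts D))"
proof -
  have "(D, j) \<in> block_index"
    using assms by (simp add: block_index_def)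
  then have "inv_into block_index (case_prod part) (part D j) = (D, j)"
    using inv_into_f_f[OF inj_part, of "(D, j)"] by simp
  then show ?thesis
    using assms by (auto simp: part_prob_def block_def)
qed

lemma pmf_pos: "D \<in> B \<Longrightarrow> pmf P D > 0"
  using B_subset by (auto simp: pmf_positive)

lemma block_prob:
  assumes "D \<in> B"
  shows "0 < block_prob D" "block_prob D < 1" "block_prob D \<le> 2 * pmf P D"
    "block_prob D = 2 * pmf P D * (1 - block_prob D)"
  using pmf_pos[OF assms] by (auto simp: block_prob_def field_simps)

lemma part_prob_bounds: "0 \<le> part_prob f" "part_prob f < 1"
proof -
  have "0 \<le> part_prob f \<and> part_prob f < 1"
  proof (cases "f \<in> (\<Union>D\<in>B. block D)")
    case True
    then obtain D j where D: "D \<in> B" "j < parts D" "f = part D j"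
      by (auto simp: block_def)
    have "block_prob D powr (1 / real (parts D)) < 1 powr (1 / real (parts D))"
      using block_prob[OF D(1)] parts_pos[of D] by (intro powr_less_mono2) auto
    then show ?thesis
      using D by (simp add: part_prob_part)
  qed (simp add: part_prob_def)
  then show "0 \<le> part_prob f" "part_prob f < 1" by auto
qed

lemma part_prob_pos: "part_prob f > 0 \<Longrightarrow> f \<in> (\<Union>D\<in>B. block D)"
  by (auto simp: part_prob_def split: if_splits)

text \<open>The comparison with the series of the hypothesis. For \<open>card D \<ge> c\<close>,
  rounding down gives \<open>c / card D \<le> 1 / parts D\<close>; the base
  \<open>block_prob D\<close> is below 1, so the smaller exponent gives the larger power, and the
  factor 2 in the base costs at most a factor 2. For \<open>card D < c\<close> there is a single
  part, which the summand \<open>2 * pmf P D\<close> pays for.\<close>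

lemma parts_prob_le:
  assumes D: "D \<in> B"
  shows "real (parts D) * block_prob D powr (1 / real (parts D))
    \<le> 2 * (real (card D) * pmf P D powr (real c / real (card D))) + 2 * pmf P D"
proof (cases "card D < c")
  case True
  then have "parts D = 1"
    by (simp add: parts_def)
  then show ?thesis
    using block_prob[OF D] by (simp add: add_increasing)
next
  case False
  let ?n = "card D" and ?m = "parts D" and ?q = "block_prob D" and ?p = "pmf P D"
  have m: "?m = ?n div c"
    using False c_pos by (simp add: parts_def div_greater_zero_iff max_def Suc_le_eq)
  have mn: "?m * c \<le> ?n"
    by (simp add: m)
  have mn': "?m \<le> ?n"
    by (simp add: m)
  have "real ?m * real c \<le> real ?n"
    using mn by (simp flip: of_nat_mult)
  then have "real c / real ?n \<le> 1 / real ?m"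
    using parts_pos[of D] card_pos[OF D] by (simp add: field_simps)
  then have "?q powr (1 / real ?m) \<le> ?q powr (real c / real ?n)"
    using block_prob[OF D] by (intro powr_mono') auto
  also have "\<dots> \<le> (2 * ?p) powr (real c / real ?n)"
    using block_prob[OF D] by (intro powr_mono2) auto
  also have "\<dots> = 2 powr (real c / real ?n) * ?p powr (real c / real ?n)"
    by (simp add: powr_mult)
  also have "\<dots> \<le> 2 powr 1 * ?p powr (real c / real ?n)"
    using False card_pos[OF D] by (intro mult_right_mono powr_mono) auto
  finally have "real ?m * ?q powr (1 / real ?m) \<le> real ?n * (2 * ?p powr (real c / real ?n))"
    using mn' by (intro mult_mono) auto
  then show ?thesis
    by (simp add: add_increasing2)
qed

lemma summable_part_prob: "part_prob summable_on UNIV"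
proof -
  have P: "pmf P summable_on B"
    using pmf_abs_summable[of P B]
    by (simp add: abs_summable_equivalent[symmetric])
  have "(\<lambda>(D, j). part_prob (part D j)) summable_on block_index"
    unfolding block_index_def
  proof (rule summable_on_SigmaI)
    fix D assume D: "D \<in> B"
    have "((\<lambda>j. part_prob (part D j)) has_sum (\<Sum>j<parts D. part_prob (part D j))) {..<parts D}"
      by (intro has_sum_finite) simp
    also have "(\<Sum>j<parts D. part_prob (part D j)) = (\<Sum>j<parts D. block_prob D powr (1 / real (parts D)))"
      using D by (intro sum.cong) (auto simp: part_prob_part)
    finally show "((\<lambda>j. case (D, j) of (D, j) \<Rightarrow> part_prob (part D j)) has_sum
        real (parts D) * block_prob D powr (1 / real (parts D))) {..<parts D}"
      by simp
  next
    show "(\<lambda>D. real (parts D) * block_prob D powr (1 / real (parts D))) summable_on B"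
    proof (rule summable_on_comparison_test)
      show "(\<lambda>D. 2 * (real (card D) * pmf P D powr (real c / real (card D))) + 2 * pmf P D) summable_on B"
        using summable_B P by (intro summable_on_add summable_on_cmult_right)
    qed (use parts_prob_le in auto)
  qed (use part_prob_bounds in auto)
  then have "part_prob summable_on (\<Union>D\<in>B. block D)"
    unfolding UN_block summable_on_reindex[OF inj_part] by (simp add: o_def case_prod_unfold)
  then show ?thesis
    by (subst summable_on_cong_neutral[where S = "\<Union>D\<in>B. block D" and g = part_prob, symmetric])
       (auto simp: part_prob_def)
qed

lemma prob_block:
  assumes Q: "independent_inclusion part_prob Q" and D: "D \<in> B"
  shows "measure_pmf.prob Q {I. full I D} = block_prob D"
proof -
  have "measure_pmf.prob Q {I. full I D} = measure_pmf.prob Q {I. block D \<subseteq> I \<and> {} \<inter> I = {}}"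
    using D by (simp add: full_def)
  also have "\<dots> = (\<Prod>f\<in>block D. part_prob f)"
    by (subst independent_inclusion_prob_finite[OF Q]) (auto simp: block_def)
  also have "\<dots> = (\<Prod>j<parts D. part_prob (part D j))"
    unfolding block_def using D part_inj by (subst prod.reindex) (auto simp: inj_on_def)
  also have "\<dots> = (block_prob D powr (1 / real (parts D))) ^ parts D"
    using D by (simp add: part_prob_part)
  also have "\<dots> = block_prob D"
    using block_prob[OF D] parts_pos[of D] by (simp add: powr_powr flip: powr_realpow)
  finally show ?thesis .
qed

text \<open>Distinct blocks are disjoint, hence independent; dividing the probability that only \<open>D\<close> is full
  by the probability that no block is full leaves the odds of \<open>D\<close>.\<close>

lemma prob_only_full:
  assumes Q: "independent_inclusion part_prob Q" and D: "D \<in> B"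
  shows "measure_pmf.prob Q {I. only_full I D}
       = 2 * pmf P D * measure_pmf.prob Q {I. \<forall>D'. \<not> full I D'}"
proof -
  let ?prob = "measure_pmf.prob Q"
  define Y where "Y = {V. \<forall>D'. full V D' \<longrightarrow> D' = D}"
  have disj: "block D \<inter> block D' = {}" if "D' \<in> B" "D' \<noteq> D" for D'
    using that D part_inj by (auto simp: block_def)
  \<comment> \<open>Removing the block of \<open>D\<close> does not affect any other block, so the
    absence of rivals depends only on the facts outside this block.\<close>
  have Y: "I - block D \<in> Y \<longleftrightarrow> (\<forall>D'. full I D' \<longrightarrow> D' = D)" for I
    using disj unfolding Y_def full_def by blast
  have full: "full I D \<longleftrightarrow> I \<inter> block D \<in> {block D}" for I
    using D by (auto simp: full_def)
  have split: "?prob {I. I \<inter> block D \<in> X \<and> I - block D \<in> Y} =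
      ?prob {I. I \<inter> block D \<in> X} * ?prob {I. I - block D \<in> Y}" for X
    using Q unfolding independent_inclusion_def by blast
  have "{I. only_full I D} = {I. I \<inter> block D \<in> {block D} \<and> I - block D \<in> Y}"
    unfolding only_full_def full Y ..
  then have only: "?prob {I. only_full I D} = block_prob D * ?prob {I. I - block D \<in> Y}"
    using prob_block[OF Q D] unfolding full by (simp only: split)
  have compl: "{I. I \<inter> block D \<in> - {block D}} = UNIV - {I. full I D}"
    unfolding full by blast
  have "?prob {I. I \<inter> block D \<in> - {block D}} = 1 - block_prob D"
    unfolding compl using prob_block[OF Q D] measure_pmf.prob_compl[of "{I. full I D}" Q] by simp
  moreover have "{I. \<forall>D'. \<not> full I D'} = {I. I \<inter> block D \<in> - {block D} \<and> I - block D \<in> Y}"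
    unfolding Compl_iff full[symmetric] Y by blast
  ultimately have none: "?prob {I. \<forall>D'. \<not> full I D'} = (1 - block_prob D) * ?prob {I. I - block D \<in> Y}"
    by (simp only: split)
  show ?thesis
    unfolding only none by (subst block_prob(4)[OF D]) (simp only: mult.assoc)
qed

text \<open>Union bound: each block is full with probability at most \<open>2 * pmf P D\<close>, and
  \<open>B\<close> has probability below 1/4. The bound 1/2 will make \<open>1 / (2 * Z)\<close> an
  admissible coin bias.\<close>

lemma prob_no_full:
  assumes Q: "independent_inclusion part_prob Q"
  shows "measure_pmf.prob Q {I. \<forall>D. \<not> full I D} > 1/2"
proof -
  have "emeasure Q {I. \<exists>D\<in>B. full I D} \<le> (\<integral>\<^sup>+D. emeasure Q {I. full I D} \<partial>count_space B)"
    by (rule emeasure_pmf_countable_subadditive) (rule countable_B)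
  also have "\<dots> \<le> (\<integral>\<^sup>+D. 2 * ennreal (pmf P D) \<partial>count_space B)"
  proof (rule nn_integral_mono)
    fix D assume "D \<in> space (count_space B)"
    then have D: "D \<in> B" by simp
    have "ennreal (block_prob D) \<le> ennreal (2 * pmf P D)"
      using block_prob[OF D] by (intro ennreal_leI)
    then show "emeasure Q {I. full I D} \<le> 2 * ennreal (pmf P D)"
      using prob_block[OF Q D] by (simp add: measure_pmf.emeasure_eq_measure ennreal_mult)
  qed
  also have "\<dots> = 2 * emeasure P B"
    by (simp add: nn_integral_cmult nn_integral_pmf)
  also have "\<dots> = ennreal (2 * measure_pmf.prob P B)"
    by (simp add: measure_pmf.emeasure_eq_measure ennreal_mult)
  finally have "measure_pmf.prob Q {I. \<exists>D\<in>B. full I D} \<le> 2 * measure_pmf.prob P B"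
    by (simp add: measure_pmf.emeasure_eq_measure)
  moreover have "{I. \<forall>D. \<not> full I D} = UNIV - {I. \<exists>D\<in>B. full I D}"
    by (auto simp: full_def)
  ultimately show ?thesis
    using prob_B measure_pmf.prob_compl[of "{I. \<exists>D\<in>B. full I D}" Q] by simp
qed

text \<open>Limits the probability that a block output takes away from the default instances. An
  upper bound suffices, as the final comparison of distributions works from below.\<close>

lemma prob_some_only_full:
  assumes Q: "independent_inclusion part_prob Q"
  shows "measure_pmf.prob Q {I. \<exists>D. only_full I D}
       \<le> 2 * measure_pmf.prob Q {I. \<forall>D. \<not> full I D} * measure_pmf.prob P B"
proof -
  let ?Z = "measure_pmf.prob Q {I. \<forall>D. \<not> full I D}"
  have "{I. \<exists>D. only_full I D} = {I. \<exists>D\<in>B. only_full I D}"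
    by (auto simp: only_full_def full_def)
  then have "emeasure Q {I. \<exists>D. only_full I D} \<le> (\<integral>\<^sup>+D. emeasure Q {I. only_full I D} \<partial>count_space B)"
    using emeasure_pmf_countable_subadditive[OF countable_B, of Q "\<lambda>D I. only_full I D"] by simp
  also have "\<dots> = (\<integral>\<^sup>+D. ennreal (2 * ?Z) * ennreal (pmf P D) \<partial>count_space B)"
    using prob_only_full[OF Q]
    by (intro nn_integral_cong) (simp add: measure_pmf.emeasure_eq_measure mult_ac flip: ennreal_mult)
  also have "\<dots> = ennreal (2 * ?Z) * emeasure P B"
    by (simp add: nn_integral_cmult nn_integral_pmf)
  also have "\<dots> = ennreal (2 * ?Z * measure_pmf.prob P B)"
    by (simp add: measure_pmf.emeasure_eq_measure flip: ennreal_mult)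
  finally show ?thesis
    by (simp add: measure_pmf.emeasure_eq_measure)
qed

end

section \<open>The tuple-independent representation\<close>

text \<open>The product telescopes: factor \<open>j\<close> is the ratio of the tail sum from
  \<open>Suc j\<close> to the tail sum from \<open>j\<close>.\<close>

lemma prod_one_minus_hazard:
  fixes w :: "nat \<Rightarrow> real"
  assumes w: "\<And>i. i \<le> m \<Longrightarrow> w i > 0" and "i \<le> m"
  shows "(\<Prod>j<i. 1 - w j / sum w {j..m}) = sum w {i..m} / sum w {0..m}"
  using \<open>i \<le> m\<close>
proof (induction i)
  case 0
  have "sum w {0..m} > 0"
    using w by (intro sum_pos) auto
  then show ?case by simp
next
  case (Suc i)
  have pos: "sum w {i..m} > 0"
    using w Suc.prems by (intro sum_pos) auto
  have "sum w {i..m} = w i + sum w {Suc i..m}"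
    using Suc.prems by (intro sum.atLeast_Suc_atMost) simp
  then have "1 - w i / sum w {i..m} = sum w {Suc i..m} / sum w {i..m}"
    using pos by (simp add: field_simps)
  then show ?case
    using Suc pos by simp
qed

text \<open>Coin \<open>i\<close> succeeds with the conditional probability of index
  \<open>i\<close> given that no smaller index was chosen. The last index has conditional
  probability 1 and therefore gets no coin, which keeps all marginals below 1.\<close>

lemma independent_choice:
  fixes w :: "nat \<Rightarrow> real"
  assumes w: "\<And>i. i \<le> m \<Longrightarrow> w i > 0" and a: "0 \<le> a" "a < 1"
  obtains Q where "tuple_independent Q"
    and "\<And>J. J \<in> set_pmf Q \<Longrightarrow> J \<subseteq> insert accept (range coin) \<and> finite J"
    and "measure_pmf.prob Q {J. accept \<in> J} = a"
    and "\<And>i. i \<le> m \<Longrightarrow> measure_pmf.prob Q {J. chosen m J i} = w i / sum w {0..m}"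
    and "\<And>i. i \<le> m \<Longrightarrow> measure_pmf.prob Q {J. accept \<in> J \<and> chosen m J i} = a * (w i / sum w {0..m})"
proof -
  define hazard where "hazard i = w i / sum w {i..m}" for i
  define p where "p f = (if f = accept then a else if f \<in> coin ` {..<m} then hazard (hd (snd f)) else 0)" for f
  have coin: "coin i \<noteq> accept" "coin i = coin j \<longleftrightarrow> i = j" "hd (snd (coin i)) = i" for i j
    by (auto simp: coin_def accept_def)
  have hazard: "0 \<le> hazard i" "hazard i < 1" if "i < m" for i
  proof -
    have "w i > 0" "sum w {Suc i..m} > 0"
      using w that by (auto intro: sum_pos)
    moreover have "sum w {i..m} = w i + sum w {Suc i..m}"
      using that by (intro sum.atLeast_Suc_atMost) simp
    ultimately show "0 \<le> hazard i" "hazard i < 1"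
      by (auto simp: hazard_def)
  qed
  have p: "p accept = a" "\<And>i. i < m \<Longrightarrow> p (coin i) = hazard i"
    using coin by (auto simp: p_def)
  have "0 \<le> p f \<and> p f < 1" for f
    using hazard a coin by (auto simp: p_def)
  moreover have "p summable_on UNIV"
    by (subst summable_on_cong_neutral[where S = "insert accept (coin ` {..<m})" and g = p, symmetric])
       (auto simp: p_def)
  ultimately obtain Q where Q: "independent_inclusion p Q"
    using independent_inclusion_exists[of p] by blast
  \<comment> \<open>The set \<open>A\<close> is empty or \<open>{accept}\<close>, which yields the
    last two claims in one computation.\<close>
  have chosen: "measure_pmf.prob Q {J. A \<subseteq> J \<and> chosen m J i} = prod p A * (w i / sum w {0..m})"
    if i: "i \<le> m" and A: "A \<subseteq> {accept}" for i A
  proof -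
    define F where "F = (if i < m then {coin i} else {})"
    define G where "G = coin ` {..<i}"
    have fin: "finite A" "finite F" "finite G"
      using A by (auto simp: F_def G_def finite_subset)
    have disj: "(A \<union> F) \<inter> G = {}" "A \<inter> F = {}"
      using A coin by (auto simp: F_def G_def)
    have "{J. A \<subseteq> J \<and> chosen m J i} = {J. A \<union> F \<subseteq> J \<and> G \<inter> J = {}}"
      using i by (auto simp: chosen_def F_def G_def)
    then have "measure_pmf.prob Q {J. A \<subseteq> J \<and> chosen m J i} = prod p (A \<union> F) * (\<Prod>f\<in>G. 1 - p f)"
      using independent_inclusion_prob_finite[OF Q _ fin(3) disj(1)] fin by simp
    also have "prod p (A \<union> F) = prod p A * prod p F"
      using fin disj by (intro prod.union_disjoint) auto
    also have "(\<Prod>f\<in>G. 1 - p f) = (\<Prod>j<i. 1 - p (coin j))"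
      unfolding G_def using coin by (subst prod.reindex) (auto simp: inj_on_def)
    also have "\<dots> = (\<Prod>j<i. 1 - w j / sum w {j..m})"
      using p(2) i by (intro prod.cong) (auto simp: hazard_def)
    also have "\<dots> = sum w {i..m} / sum w {0..m}"
      using w i by (rule prod_one_minus_hazard)
    \<comment> \<open>For \<open>i = m\<close> the set \<open>F\<close> is empty, and both sides
      equal 1.\<close>
    also have "prod p F = w i / sum w {i..m}"
      using i w[of m] p(2) by (auto simp: F_def hazard_def)
    also have "prod p A * (w i / sum w {i..m}) * (sum w {i..m} / sum w {0..m}) = prod p A * (w i / sum w {0..m})"
    proof -
      have "sum w {i..m} > 0"
        using w i by (intro sum_pos) auto
      then show ?thesis by simp
    qed
    finally show ?thesis .
  qed
  have supp: "J \<subseteq> insert accept (range coin) \<and> finite J" if "J \<in> set_pmf Q" for J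
  proof -
    have "finite J" "\<forall>f\<in>J. p f > 0"
      using Q that unfolding independent_inclusion_def by blast+
    then show ?thesis
      by (force simp: p_def split: if_splits)
  qed
  have acc: "measure_pmf.prob Q {J. accept \<in> J} = a"
    using Q p(1) unfolding independent_inclusion_def by blast
  show ?thesis
    using tuple_independent_if_independent_inclusion[OF Q] supp acc chosen[of _ "{}"] chosen[of _ "{accept}"]
    by (intro that[of Q]) (simp_all add: p(1))
qed

context block_model
begin

lemma in_FO_TI_if_B_cofinite:
  assumes S: "schema S" and Fs: "Fs \<noteq> []" "distinct Fs" "set Fs \<subseteq> set_pmf P"
    and Fs_inst: "\<And>D. D \<in> set Fs \<Longrightarrow> is_instance S D" and B: "B = set_pmf P - set Fs"
  shows "in_FO_TI S P"
proof -
  let ?blocks = "\<Union>D\<in>B. block D"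
  define m where "m = length Fs - 1"
  define w where "w i = pmf P (Fs ! i)" for i
  obtain Q where Q: "independent_inclusion part_prob Q"
    using independent_inclusion_exists[OF part_prob_bounds summable_part_prob] by blast
  define Z where "Z = measure_pmf.prob Q {I. \<forall>D. \<not> full I D}"
  have Z: "Z > 1/2"
    using prob_no_full[OF Q] by (simp add: Z_def)
  have m: "i \<le> m \<longleftrightarrow> i < length Fs" for i
    using Fs(1) by (cases Fs) (auto simp: m_def less_Suc_eq_le)
  have w: "w i > 0" if "i \<le> m" for i
    using that m Fs(3) by (auto simp: w_def intro!: pmf_positive)
  have W: "sum w {0..m} = 1 - measure_pmf.prob P B"
  proof -
    have "{0..m} = {..<length Fs}"
      unfolding set_eq_iff atLeastAtMost_iff lessThan_iff m by simp
    then have "sum w {0..m} = (\<Sum>i<length Fs. pmf P (Fs ! i))"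
      by (simp add: w_def)
    also have "\<dots> = sum (pmf P) (set Fs)"
      using Fs(2) by (intro sum.reindex_bij_betw bij_betw_nth) auto
    also have "\<dots> = measure_pmf.prob P (set Fs)"
      by (simp add: measure_measure_pmf_finite)
    also have "\<dots> = measure_pmf.prob P (UNIV - B)"
      unfolding B by (rule measure_pmf.finite_measure_eq_AE) (auto simp: AE_measure_pmf_iff)
    finally show ?thesis
      using measure_pmf.prob_compl[of B P] by simp
  qed
  \<comment> \<open>The bias cancels the factor \<open>2 * Z\<close> by which the probability of
    \<open>D\<close> being the only full block exceeds \<open>pmf P D\<close>.\<close>
  have a: "0 \<le> 1 / (2 * Z)" "1 / (2 * Z) < 1"
    using Z by (auto simp: field_simps)
  obtain Q' where Q': "tuple_independent Q'"
    and supp': "\<And>J. J \<in> set_pmf Q' \<Longrightarrow> J \<subseteq> insert accept (range coin) \<and> finite J"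
    and acc: "measure_pmf.prob Q' {J. accept \<in> J} = 1 / (2 * Z)"
    and chosen: "\<And>i. i \<le> m \<Longrightarrow> measure_pmf.prob Q' {J. chosen m J i} = w i / sum w {0..m}"
    and acc_chosen: "\<And>i. i \<le> m \<Longrightarrow> measure_pmf.prob Q' {J. accept \<in> J \<and> chosen m J i}
        = 1 / (2 * Z) * (w i / sum w {0..m})"
    by (rule independent_choice[of m w "1 / (2 * Z)"]) (use w a in auto)
  have supp: "I \<subseteq> ?blocks \<and> finite I" if "I \<in> set_pmf Q" for I
    using Q that part_prob_pos unfolding independent_inclusion_def by blast
  have blocks: "f \<in> ?blocks \<Longrightarrow> \<exists>us. f = (T, us) \<and> length us = Suc (width slots r)" for f
    using length_cells by (auto simp: block_def part_def)
  have notin: "accept \<notin> ?blocks" "coin i \<notin> ?blocks" for i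
    using blocks[of accept] blocks[of "coin i"] by (auto simp: accept_def coin_def)
  define R where "R = pair_pmf Q Q'"
  define P0 where "P0 = map_pmf (\<lambda>(I, J). I \<union> J) R"
  define \<Phi> where "\<Phi> = view_fo T slots r Fs"
  have union: "accept \<in> I \<union> J \<longleftrightarrow> accept \<in> J" "chosen m (I \<union> J) i \<longleftrightarrow> chosen m J i"
      "only_full (I \<union> J) D \<longleftrightarrow> only_full I D"
      "(T, us) \<in> I \<union> J \<Longrightarrow> (T, us) \<in> ?blocks"
    if "(I, J) \<in> set_pmf R" for I J i D us
  proof -
    have I: "I \<subseteq> ?blocks" and J: "J \<subseteq> insert accept (range coin)"
      using that supp supp' by (auto simp: R_def)
    have "accept \<notin> I" "coin i \<notin> I" for i
      using I notin by blast+
    then show "accept \<in> I \<union> J \<longleftrightarrow> accept \<in> J" "chosen m (I \<union> J) i \<longleftrightarrow> chosen m J i"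
      by (simp_all add: chosen_def)
    have "full (I \<union> J) D \<longleftrightarrow> full I D" for D
    proof -
      have "J \<inter> ?blocks = {}"
        using J notin by auto
      then show ?thesis
        unfolding full_def by blast
    qed
    then show "only_full (I \<union> J) D \<longleftrightarrow> only_full I D"
      by (simp add: only_full_def)
    show "(T, us) \<in> ?blocks" if "(T, us) \<in> I \<union> J"
      using I J that by (auto simp: accept_def coin_def)
  qed
  have view_block: "apply_view S \<Phi> (I \<union> J) = D"
    if IJ: "(I, J) \<in> set_pmf R" and *: "accept \<in> J" "only_full I D" for I J D
    unfolding \<Phi>_def by (rule apply_view_encoding(1))
      (use * union(1,3)[OF IJ] union(4)[OF IJ] Fs(1) Fs_inst in blast)+
  have view_default: "apply_view S \<Phi> (I \<union> J) = Fs ! i"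
    if IJ: "(I, J) \<in> set_pmf R" and *: "\<not> (accept \<in> J \<and> (\<exists>D. only_full I D))" "chosen m J i" for I J i
    unfolding \<Phi>_def by (rule apply_view_encoding(2))
      (use * union(1-3)[OF IJ] union(4)[OF IJ] Fs(1) Fs_inst in \<open>simp add: m_def; blast\<close>)+
  have mono: "measure_pmf.prob R E \<le> pmf (map_pmf (apply_view S \<Phi>) P0) D"
    if E: "\<And>I J. (I, J) \<in> set_pmf R \<Longrightarrow> (I, J) \<in> E \<Longrightarrow> apply_view S \<Phi> (I \<union> J) = D" for E D
  proof -
    have "measure_pmf.prob R E \<le> measure_pmf.prob R {(I, J). apply_view S \<Phi> (I \<union> J) = D}"
      using E by (intro measure_pmf.finite_measure_mono_AE) (auto simp: AE_measure_pmf_iff)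
    also have "\<dots> = pmf (map_pmf (apply_view S \<Phi>) P0) D"
      by (simp add: P0_def pmf_map map_pmf_comp vimage_def case_prod_unfold)
    finally show ?thesis .
  qed
  \<comment> \<open>A pointwise lower bound is enough, because both distributions have total mass 1.
    So for each \<open>D\<close> it suffices to find an event of sufficient probability on which the
    view outputs \<open>D\<close>.\<close>
  have le: "pmf P D \<le> pmf (map_pmf (apply_view S \<Phi>) P0) D" if D: "D \<in> set_pmf P" for D
  proof (cases "D \<in> B")
    case True
    have "pmf P D = measure_pmf.prob Q {I. only_full I D} * measure_pmf.prob Q' {J. accept \<in> J}"
      using Z unfolding prob_only_full[OF Q True] acc Z_def[symmetric] by simp
    also have "\<dots> = measure_pmf.prob R ({I. only_full I D} \<times> {J. accept \<in> J})"
      by (simp add: R_def prob_pair_pmf_Times)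
    also have "\<dots> \<le> pmf (map_pmf (apply_view S \<Phi>) P0) D"
      using view_block by (intro mono) auto
    finally show ?thesis .
  next
    case False
    then obtain i where i: "i \<le> m" "Fs ! i = D"
      using D unfolding B m by (auto simp: in_set_conv_nth)
    let ?U = "{I. \<exists>D. only_full I D}"
    \<comment> \<open>Default \<open>i\<close> is output when its index is chosen,
      \<open>?E\<close>, except when an accepted unique block overrides it,
      \<open>?E'\<close>.\<close>
    let ?E = "UNIV \<times> {J. chosen m J i}"
    let ?E' = "?U \<times> {J. accept \<in> J \<and> chosen m J i}"
    have W0: "sum w {0..m} > 0"
      using prob_B by (simp add: W)
    \<comment> \<open>Overriding has probability at most that of \<open>B\<close>, so the defaults
      keep at least \<open>sum w {0..m}\<close>; this absorbs the denominator of
      \<open>w i / sum w {0..m}\<close>.\<close>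
    have "measure_pmf.prob Q ?U * (1 / (2 * Z)) \<le> measure_pmf.prob P B"
      using prob_some_only_full[OF Q] Z by (simp add: Z_def[symmetric] field_simps)
    then have "sum w {0..m} \<le> 1 - measure_pmf.prob Q ?U * (1 / (2 * Z))"
      by (simp add: W)
    then have "w i / sum w {0..m} * sum w {0..m}
        \<le> w i / sum w {0..m} * (1 - measure_pmf.prob Q ?U * (1 / (2 * Z)))"
      using w[OF i(1)] W0 by (intro mult_left_mono) auto
    then have "pmf P D \<le> w i / sum w {0..m} - measure_pmf.prob Q ?U * (1 / (2 * Z) * (w i / sum w {0..m}))"
      using W0 i by (simp add: w_def right_diff_distrib mult_ac)
    also have "\<dots> = measure_pmf.prob R ?E - measure_pmf.prob R ?E'"
      using chosen[OF i(1)] acc_chosen[OF i(1)] by (simp add: R_def prob_pair_pmf_Times)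
    also have "\<dots> = measure_pmf.prob R (?E - ?E')"
      by (rule measure_pmf.finite_measure_Diff[symmetric]) auto
    also have "\<dots> \<le> pmf (map_pmf (apply_view S \<Phi>) P0) D"
      using view_default[of _ _ i] i(2) by (intro mono) auto
    finally show ?thesis .
  qed
  have "map_pmf (apply_view S \<Phi>) P0 = P"
  proof (rule ccontr)
    assume "map_pmf (apply_view S \<Phi>) P0 \<noteq> P"
    then obtain D where D: "pmf (map_pmf (apply_view S \<Phi>) P0) D < pmf P D"
      using pmf_neq_exists_less by blast
    then have "D \<in> set_pmf P"
      using pmf_nonneg[of "map_pmf (apply_view S \<Phi>) P0" D] by (auto simp: set_pmf_iff)
    with le D show False by fastforce
  qed
  moreover have "is_TI {T, (1, 1), (2, 0)} P0"
    unfolding is_TI_def is_PDB_def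
  proof (intro conjI ballI)
    show "schema {T, (1, 1), (2, 0)}"
      by (simp add: schema_def)
    show "tuple_independent P0"
      unfolding P0_def R_def
    proof (rule tuple_independent_Un[where A = ?blocks])
      show "I \<inter> ?blocks = {}" if "I \<in> set_pmf Q'" for I
        using supp'[OF that] notin by auto
    qed (use supp Q' tuple_independent_if_independent_inclusion[OF Q] in auto)
    fix D assume "D \<in> set_pmf P0"
    then obtain I J where IJ: "I \<in> set_pmf Q" "J \<in> set_pmf Q'" "D = I \<union> J"
      by (auto simp: P0_def R_def)
    have "I \<subseteq> facts_over {T, (1, 1), (2, 0)}"
      using supp[OF IJ(1)] blocks by (fastforce simp: facts_over_def arity_def)
    moreover have "J \<subseteq> facts_over {T, (1, 1), (2, 0)}"
      using supp'[OF IJ(2)] by (auto simp: facts_over_def arity_def accept_def coin_def)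
    ultimately show "is_instance {T, (1, 1), (2, 0)} D"
      using supp[OF IJ(1)] supp'[OF IJ(2)] IJ(3) by (simp add: is_instance_def)
  qed
  moreover have "FO_view {T, (1, 1), (2, 0)} S \<Phi>"
    unfolding \<Phi>_def using S arity_le Fs_inst by (rule FO_view_view_fo)
  ultimately show ?thesis
    unfolding in_FO_TI_def by blast
qed

end

section \<open>Choice of the finite part and conclusion\<close>

lemma finite_prob_gt:
  assumes "e < 1"
  obtains F where "finite F" "measure_pmf.prob P F > e"
proof -
  have "Infinite_Set_Sum.abs_summable_on (pmf P) UNIV"
    by (rule pmf_abs_summable)
  then have *: "pmf P summable_on UNIV" "infsum (pmf P) UNIV = 1"
    using infsetsum_infsum[of "pmf P" UNIV] infsetsum_pmf_eq_1[of P UNIV]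
    by (simp_all add: abs_summable_equivalent[symmetric])
  obtain F where F: "finite F" "dist (sum (pmf P) F) (infsum (pmf P) UNIV) \<le> (1 - e) / 2"
    using infsum_finite_approximation[OF *(1), of "(1 - e) / 2"] assms by auto
  then have "sum (pmf P) F > e"
    using assms unfolding *(2) dist_real_def by (simp add: abs_if split: if_splits)
  with F show ?thesis
    by (intro that[of F]) (simp_all add: measure_measure_pmf_finite)
qed

theorem theorem5p2:
  fixes S :: "rel set" and P :: "inst pmf" and c :: nat
  assumes "is_PDB S P"
    and "c > 0"
    and "(\<lambda>D. real (card D) * pmf P D powr (real c / real (card D)))
           summable_on (set_pmf P - {{}})"
  shows "in_FO_TI S P"
proof -
  have S: "schema S" and inst: "\<And>D. D \<in> set_pmf P \<Longrightarrow> is_instance S D"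
    using assms(1) by (auto simp: is_PDB_def)
  obtain F0 where F0: "finite F0" "measure_pmf.prob P F0 > 3/4"
    using finite_prob_gt[of "3/4" P] by auto
  \<comment> \<open>The empty instance belongs to the defaults, as it has no facts to fill slots
    with and the series omits it. Intersecting with the support gives every default a positive
    weight.\<close>
  define F where "F = insert {} F0 \<inter> set_pmf P"
  define B where "B = set_pmf P - F"
  have "measure_pmf.prob P F0 \<le> measure_pmf.prob P F"
    by (intro measure_pmf.finite_measure_mono_AE) (auto simp: F_def AE_measure_pmf_iff)
  with F0 have F: "measure_pmf.prob P F > 3/4" by simp
  obtain Fs where Fs: "set Fs = F" "distinct Fs"
    using F0(1) finite_distinct_list[of F] by (auto simp: F_def)
  have "Fs \<noteq> []"
    using F Fs by auto
  define r where "r = Max (arity ` S)"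
  have "measure_pmf.prob P B \<le> measure_pmf.prob P (UNIV - F)"
    by (intro measure_pmf.finite_measure_mono) (auto simp: B_def)
  then have prob_B: "measure_pmf.prob P B < 1/4"
    using F measure_pmf.prob_compl[of F P] by simp
  interpret block_model S c r B P
  proof
    show "arity R \<le> r" if "R \<in> S" for R
      using that S by (auto simp: r_def schema_def)
    show "(\<lambda>D. real (card D) * pmf P D powr (real c / real (card D))) summable_on B"
      by (rule summable_on_subset_banach[OF assms(3)]) (auto simp: B_def F_def)
  qed (use assms(2) inst prob_B in \<open>auto simp: B_def F_def\<close>)
  show ?thesis
    using S \<open>Fs \<noteq> []\<close> Fs inst by (intro in_FO_TI_if_B_cofinite[of Fs]) (auto simp: F_def B_def)
qed

end
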